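(* Let $F := (f_1, \ldots, f_p) \colon \mathbb{R}^n \rightarrow \mathbb{R}^p$, $1 \le p \le n$, be a polynomial map which is convenient and non-degenerate at infinity. Let $f(x) := \max_{i = 1, \ldots, p} f_i(x)$ and suppose $\{x \in \mathbb{R}^n : f(x) \le 0\} \ne \emptyset$. Then there exist some constants $c > 0$ and $R > 0$ such that $$\mathfrak{m}_f(x) \ge c \quad \text{for all } x\in\mathbb{R}^n \text{ with } \|x\| \ge R.$$ In particular, the function $f$ is good at infinity.
   Context: Nonsmooth slope. For a continuous function $f\colon\mathbb{R}^n\to\mathbb{R}$, the Fréchet subdifferential at $x$ is $$\hat\partial f(x) := \Big\{v\in\mathbb{R}^n : \liminf_{\|h\|\to 0,\ h\neq 0}\frac{f(x+h)-f(x)-\langle v,h\rangle}{\|h\|}\ge 0\Big\},$$ and the limiting subdifferential $\partial f(x)$ is the set of all cluster points of sequences $\{v^k\}_{k\ge1}$ such that $v^k\in\hat\partial f(x^k)$ and $(x^k,f(x^k))\to(x,f(x))$ as $k\to\infty$. The nonsmooth slope is $\mathfrak{m}_f(x) := \inf\{\|v\| : v\in\partial f(x)\}$, with $\mathfrak{m}_f(x)=+\infty$ if $\partial f(x)=\emptyset$. A continuous function $f$ is good at infinity if there exist constants $c>0$ and $R>0$ such that $\mathfrak{m}_f(x)\ge c$ for all $x\in f^{-1}((0,+\infty))$ with $\|x\|\ge R$. Newton polyhedra. For a polynomial $g = \sum_\kappa a_\kappa x^\kappa$ on $\mathbb{R}^n$, let $\mathrm{supp}(g) := \{\kappa \in \mathbb{Z}_{\ge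 0}^n : a_\kappa \neq 0\}$; the Newton polyhedron at infinity $\Gamma(g)$ is the convex hull in $\mathbb{R}^n$ of $\mathrm{supp}(g)\cup\{0\}$ (and $\Gamma(g)=\emptyset$ if $g\equiv 0$). The polynomial $g$ is convenient if $\Gamma(g)$ meets each coordinate axis in a point different from the origin, i.e. for each $j \in\{1,\ldots,n\}$ there is an integer $m_j>0$ with $m_j e_j\in\Gamma(g)$, where $e_1,\dots,e_n$ is the canonical basis. For such a polyhedron $\Gamma$ and $q\in\mathbb{R}^n$, let $d(q,\Gamma) := \min\{\langle q,\kappa\rangle : \kappa\in\Gamma\}$ and $\Delta(q,\Gamma):=\{\kappa\in\Gamma : \langle q,\kappa\rangle = d(q,\Gamma)\}$; the faces of $\Gamma$ are the sets $\Delta(q,\Gamma)$, $q\in\mathbb{R}^n$. For a face $\Delta$ of $\Gamma(g)$, $g_\Delta := \sum_{\kappa\in\Delta} a_\kappa x^\kappa$. For $F=(f_1,\ldots,f_p)$ with $1\le p\le n$, let $\Gamma(F) := \Gamma(f_1)+\cdots+\Gamma(f_p)$ (Minkowski sum) and let $\Gamma_\infty(F)$ be the set of faces of $\Gamma(F)$ that do not contain the origin. Each face $\Delta$ of $\Gamma(F)$ decomposes uniquely as $\Delta=\Delta_1+\cdots+\Delta_p$ with $\Delta_i$ a face of $\Gamma(f_i)$ (if $\Delta=\Delta(q,\Gamma(F))$, then $\Delta_i=\Delta(q,\Gamma(f_i))$). $F$ is convenient if all $f_i$ are convenient. $F$ is non-degenerate at infinity if for every face $\Delta\in\Gamma_\infty(F)$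 and every $x\in(\mathbb{R}\setminus\{0\})^n$, the $p\times(n+p)$ matrix $$M_\Delta := \begin{pmatrix} x_1\frac{\partial f_{1,\Delta_1}}{\partial x_1}(x) & \cdots & x_n\frac{\partial f_{1,\Delta_1}}{\partial x_n}(x) & f_{1,\Delta_1}(x) & \cdots & 0\\ \vdots & & \vdots & & \ddots & \\ x_1\frac{\partial f_{p,\Delta_p}}{\partial x_1}(x) & \cdots & x_n\frac{\partial f_{p,\Delta_p}}{\partial x_n}(x) & 0 & \cdots & f_{p,\Delta_p}(x)\end{pmatrix}$$ has rank $p$, where $f_{i,\Delta_i}:=(f_i)_{\Delta_i}$ and the last $p$ columns form the diagonal matrix with entries $f_{1,\Delta_1}(x),\ldots,f_{p,\Delta_p}(x)$. *)

theory Defs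
  imports
    "HOL-Analysis.Analysis"
    "HOL-Library.Poly_Mapping"
    "HOL-Library.Set_Algebras"
begin

section \<open>Nonsmooth slope\<close>

definition frechet_subdifferential ::
  "('a::euclidean_space \<Rightarrow> real) \<Rightarrow> 'a \<Rightarrow> 'a set" where
  "frechet_subdifferential f x =
     {v. Liminf (at 0) (\<lambda>h. ereal ((f (x + h) - f x - v \<bullet> h) / norm h)) \<ge> 0}"

text \<open>A cluster point of a sequence is the limit of one of its subsequences.\<close>

definition limiting_subdifferential ::
  "('a::euclidean_space \<Rightarrow> real) \<Rightarrow> 'a \<Rightarrow> 'a set" where
  "limiting_subdifferential f x =
     {v. \<exists>(X :: nat \<Rightarrow> 'a) V r.
          (\<forall>k. V k \<in> frechet_subdifferential f (X k)) \<and>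
          (\<lambda>k. (X k, f (X k))) \<longlonglongrightarrow> (x, f x) \<and>
          strict_mono r \<and> (V \<circ> r) \<longlonglongrightarrow> v}"

text \<open>The infimum is taken in the extended reals, so it is \<open>\<infinity>\<close> when there are no
  limiting subgradients.\<close>

definition nonsmooth_slope :: "('a::euclidean_space \<Rightarrow> real) \<Rightarrow> 'a \<Rightarrow> ereal" where
  "nonsmooth_slope f x = (INF v \<in> limiting_subdifferential f x. ereal (norm v))"

definition good_at_infinity :: "('a::euclidean_space \<Rightarrow> real) \<Rightarrow> bool" where
  "good_at_infinity f \<longleftrightarrow>
     continuous_on UNIV f \<and>
     (\<exists>c>0. \<exists>R>0. \<forall>x. f x > 0 \<and> norm x \<ge> R \<longrightarrow> nonsmooth_slope f x \<ge> ereal c)"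


section \<open>Polynomials and Newton polyhedra at infinity\<close>

text \<open>A real polynomial in variables indexed by \<open>'n\<close> is the finitely supported map
  sending an exponent vector to its coefficient; \<^const>\<open>Poly_Mapping.keys\<close> is then its support.\<close>

type_synonym 'n rpoly = "(nat ^ 'n) \<Rightarrow>\<^sub>0 real"

definition poly_eval :: "'n::finite rpoly \<Rightarrow> real ^ 'n \<Rightarrow> real" where
  "poly_eval g x =
     (\<Sum>\<kappa>\<in>Poly_Mapping.keys g. Poly_Mapping.lookup g \<kappa> * (\<Prod>j\<in>UNIV. (x $ j) ^ (\<kappa> $ j)))"

definition partial_deriv :: "'n::finite \<Rightarrow> (real ^ 'n \<Rightarrow> real) \<Rightarrow> real ^ 'n \<Rightarrow> real" where
  "partial_deriv j h x = frechet_derivative h (at x) (axis j 1)"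

definition exponent_point :: "nat ^ 'n \<Rightarrow> real ^ 'n::finite" where
  "exponent_point \<kappa> = (\<chi> j. real (\<kappa> $ j))"

definition newton_polyhedron :: "'n::finite rpoly \<Rightarrow> (real ^ 'n) set" where
  "newton_polyhedron g =
     (if g = 0 then {} else convex hull (exponent_point ` Poly_Mapping.keys g \<union> {0}))"

definition convenient :: "'n::finite rpoly \<Rightarrow> bool" where
  "convenient g \<longleftrightarrow>
     (\<forall>j. \<exists>m::nat. m > 0 \<and> real m *\<^sub>R axis j 1 \<in> newton_polyhedron g)"

text \<open>The infimum is attained on the nonempty compact sets to which \<open>support_min\<close> is applied.\<close>

definition support_min :: "real ^ 'n::finite \<Rightarrow> (real ^ 'n) set \<Rightarrow> real" where
  "support_min q \<Gamma> = (INF \<kappa>\<in>\<Gamma>. q \<bullet> \<kappa>)"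

definition face_at :: "real ^ 'n::finite \<Rightarrow> (real ^ 'n) set \<Rightarrow> (real ^ 'n) set" where
  "face_at q \<Gamma> = {\<kappa> \<in> \<Gamma>. q \<bullet> \<kappa> = support_min q \<Gamma>}"

definition faces :: "(real ^ 'n::finite) set \<Rightarrow> (real ^ 'n) set set" where
  "faces \<Gamma> = range (\<lambda>q. face_at q \<Gamma>)"

definition face_part :: "'n::finite rpoly \<Rightarrow> (real ^ 'n) set \<Rightarrow> 'n rpoly" where
  "face_part g \<Delta> =
     (\<Sum>\<kappa> | \<kappa> \<in> Poly_Mapping.keys g \<and> exponent_point \<kappa> \<in> \<Delta>.
        Poly_Mapping.single \<kappa> (Poly_Mapping.lookup g \<kappa>))"


section \<open>Polynomial maps\<close>

text \<open>A polynomial map has components indexed by a finite type \<open>'p\<close>. Sums of sets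
  are Minkowski sums.\<close>

definition convenient_map :: "('p::finite \<Rightarrow> 'n::finite rpoly) \<Rightarrow> bool" where
  "convenient_map F \<longleftrightarrow> (\<forall>i. convenient (F i))"

definition newton_polyhedron_map :: "('p::finite \<Rightarrow> 'n::finite rpoly) \<Rightarrow> (real ^ 'n) set" where
  "newton_polyhedron_map F = (\<Sum>i\<in>UNIV. newton_polyhedron (F i))"

definition faces_at_infinity ::
  "('p::finite \<Rightarrow> 'n::finite rpoly) \<Rightarrow> (real ^ 'n) set set" where
  "faces_at_infinity F = {\<Delta> \<in> faces (newton_polyhedron_map F). 0 \<notin> \<Delta>}"

text \<open>When all the polyhedra are nonempty, each face of the Minkowski sum has exactly
  one decomposition: \<open>face_at q\<close> of the sum is the sum of the sets \<open>face_at q\<close> of the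
  summands.\<close>

definition face_decomposition ::
  "('p::finite \<Rightarrow> 'n::finite rpoly) \<Rightarrow> (real ^ 'n) set \<Rightarrow> ('p \<Rightarrow> (real ^ 'n) set) \<Rightarrow> bool" where
  "face_decomposition F \<Delta> D \<longleftrightarrow>
     (\<forall>i. D i \<in> faces (newton_polyhedron (F i))) \<and> \<Delta> = (\<Sum>i\<in>UNIV. D i)"

text \<open>The columns are indexed by \<open>'n + 'p\<close>: the first block holds the
  logarithmic partial derivatives, the second one is diagonal.\<close>

definition face_matrix ::
  "('p::finite \<Rightarrow> 'n::finite rpoly) \<Rightarrow> ('p \<Rightarrow> (real ^ 'n) set) \<Rightarrow> real ^ 'n
     \<Rightarrow> real ^ ('n + 'p) ^ 'p" where
  "face_matrix F D x =
     (\<chi> i s. case s of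
        Inl j \<Rightarrow> x $ j * partial_deriv j (poly_eval (face_part (F i) (D i))) x
      | Inr k \<Rightarrow> (if k = i then poly_eval (face_part (F i) (D i)) x else 0))"

definition nondegenerate_at_infinity :: "('p::finite \<Rightarrow> 'n::finite rpoly) \<Rightarrow> bool" where
  "nondegenerate_at_infinity F \<longleftrightarrow>
     (\<forall>\<Delta> \<in> faces_at_infinity F. \<forall>D. face_decomposition F \<Delta> D \<longrightarrow>
        (\<forall>x. (\<forall>j. x $ j \<noteq> 0) \<longrightarrow> rank (face_matrix F D x) = CARD('p)))"

definition max_function :: "('p::finite \<Rightarrow> 'n::finite rpoly) \<Rightarrow> real ^ 'n \<Rightarrow> real" where
  "max_function F x = (MAX i. poly_eval (F i) x)"

end

theory Submission
  imports Defs
begin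

text \<open>Why the slope stays away from zero. Suppose that points escape to infinity and carry Frechet
subgradients of \<open>max\<^sub>i f\<^sub>i\<close> that tend to \<open>0\<close>. Each such subgradient is a convex
combination \<open>\<Sum>\<^sub>i \<mu>\<^sub>i \<nabla>f\<^sub>i(x)\<close> over the active indices (\<open>frechet_subgradient_max\<close>). Since the
three conditions - small gradient combination, multipliers of total mass at least \<open>1\<close>, and
\<open>\<mu>\<^sub>i (f\<^sub>i(x) - f(x))\<close> small - are stable under perturbation, all coordinates \<open>x\<^sub>j\<close> can be
made nonzero and all multipliers \<open>\<mu>\<^sub>i\<close> positive (\<open>approximate_generic_multipliers\<close>), so that
logarithms may be taken of everything.

A standard tool here is the curve selection lemma: a curve \<open>x\<^sub>j \<sim> y\<^sub>j t ^ q\<^sub>j\<close> of such points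
has exponents \<open>q\<close> and leading coefficients \<open>y\<close>. The same data can be read off a mere sequence,
because only finitely many monomials have to be compared. Let \<open>u\<^sub>k\<close> collect the numbers
\<open>ln \<bar>x\<^sub>j\<bar>\<close> and \<open>ln \<mu>\<^sub>i\<close>. By \<open>tropical_limit\<close> there are a subsequence and vectors \<open>q\<close>, \<open>z\<close> such that
each of finitely many functionals \<open>l \<bullet> u\<^sub>k\<close> tends to \<open>\<infinity>\<close>, \<open>l \<bullet> z\<close> or \<open>- \<infinity>\<close> according to the sign of
\<open>l \<bullet> q\<close>. Hence the monomials of \<open>f\<^sub>i\<close> that dominate along the subsequence are those on the face
\<open>\<Delta>\<^sub>i\<close> of the Newton polyhedron where \<open>q\<close> is maximal, and with \<open>M\<^sub>i\<close> the size of such a monomial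
\<open>f\<^sub>i / M\<^sub>i\<close> and \<open>x\<^sub>j \<partial>\<^sub>j f\<^sub>i / M\<^sub>i\<close> converge, up to a common positive factor, to the values of the
face polynomial and of its logarithmic derivatives at the point \<open>y\<close>, \<open>y\<^sub>j = \<plusminus> exp z\<^sub>j\<close>
(\<open>leading_form_limit\<close>).

The contradiction is \<open>degenerate_limit_contradiction\<close>. Convenience gives every \<open>f\<^sub>i\<close> a positive
degree \<open>d\<^sub>i\<close> with respect to \<open>q\<close>, so the face does not contain the origin, and also makes the
largest of the sizes \<open>\<mu>\<^sub>i M\<^sub>i\<close> grow at least as fast as every \<open>\<bar>x\<^sub>j\<bar>\<close>. Dividing
\<open>x\<^sub>j \<Sum>\<^sub>i \<mu>\<^sub>i \<partial>\<^sub>j f\<^sub>i\<close> by this largest size therefore leaves in the limit a linear relation, with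
coefficients \<open>c\<^sub>i \<ge> 0\<close>, between the logarithmic gradients of the face polynomials. By Euler's
identity for quasi-homogeneous polynomials, \<open>\<Sum>\<^sub>i c\<^sub>i d\<^sub>i A\<^sub>i = 0\<close>, where \<open>A\<^sub>i\<close> is the
limit of \<open>f\<^sub>i / M\<^sub>i\<close>. But where \<open>c\<^sub>i > 0\<close>, also the common value \<open>f\<close> satisfies
\<open>f / M\<^sub>i \<longlonglongrightarrow> A\<^sub>i\<close>, so those \<open>A\<^sub>i\<close> never have opposite signs and must all vanish. Then the
rows of the matrix of nondegeneracy at \<open>y\<close> are linearly dependent.

Passing from Frechet to limiting subgradients costs nothing: a lower bound on the norms of
Frechet subgradients near a point survives in the limit (\<open>nonsmooth_slope_ge\<close>).\<close>

section \<open>Subgradients of a maximum\<close>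

lemma continuous_on_MAX:
  fixes f :: "'p::finite \<Rightarrow> 'a::topological_space \<Rightarrow> real"
  assumes "\<And>i. continuous_on S (f i)"
  shows "continuous_on S (\<lambda>x. MAX i. f i x)"
proof -
  have "continuous_on S (\<lambda>x. Max ((\<lambda>i. f i x) ` I))" if "finite I" "I \<noteq> {}" for I
    using that by (induction rule: finite_ne_induct) (auto intro!: continuous_intros assms)
  from this[of UNIV] show ?thesis by simp
qed

text \<open>Along a ray the Frechet condition loses its \<open>norm h\<close>: the error is an arbitrarily small multiple of \<open>t\<close>.\<close>

lemma frechet_subgradient_along_ray:
  fixes f :: "'a::euclidean_space \<Rightarrow> real"
  assumes v: "v \<in> frechet_subdifferential f x" and h: "h \<noteq> 0" and e: "e > 0"
  shows "\<forall>\<^sub>F t in at_right (0::real). f (x + t *\<^sub>R h) > f x + t * (v \<bullet> h - e)"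
proof -
  have "ereal (- (e / norm h)) < 0" using h e by simp
  moreover have "0 \<le> Liminf (at 0) (\<lambda>h. ereal ((f (x + h) - f x - v \<bullet> h) / norm h))"
    using v by (simp add: frechet_subdifferential_def)
  ultimately have ev: "\<forall>\<^sub>F y in at 0. - (e / norm h) < (f (x + y) - f x - v \<bullet> y) / norm y"
    unfolding le_Liminf_iff by fastforce
  have "filterlim (\<lambda>t. t *\<^sub>R h) (at 0) (at_right (0::real))"
    unfolding filterlim_at using h
    by (auto intro!: tendsto_eq_intros simp: eventually_at_right_less eventually_at_filter)
  from eventually_compose_filterlim[OF ev this] eventually_at_right_less[of 0]
  show ?thesis
  proof eventually_elim
    case (elim t)
    then have "- (e / norm h) * (t * norm h) < f (x + t *\<^sub>R h) - f x - v \<bullet> (t *\<^sub>R h)"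
      using h by (simp add: pos_less_divide_eq)
    then show ?case using h by (simp add: algebra_simps)
  qed
qed

text \<open>If \<open>v\<close> were outside the convex hull of the active gradients, a separating hyperplane would give
a direction \<open>h\<close> in which every active function grows at a rate smaller than \<open>v \<bullet> h\<close> by a fixed
amount; the inactive functions stay below the maximum for short steps, so the maximum itself would
grow too slowly for a subgradient \<open>v\<close>.\<close>

lemma frechet_subgradient_max:
  fixes f :: "'p::finite \<Rightarrow> 'a::euclidean_space \<Rightarrow> real"
  assumes deriv: "\<And>i. (f i has_derivative (\<lambda>h. g i \<bullet> h)) (at x)"
    and v: "v \<in> frechet_subdifferential (\<lambda>x. MAX i. f i x) x"
  obtains \<mu> :: "'p \<Rightarrow> real" where "\<And>i. \<mu> i \<ge> 0" "sum \<mu> UNIV = 1"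
    "\<And>i. \<mu> i \<noteq> 0 \<Longrightarrow> f i x = (MAX i. f i x)" "v = (\<Sum>i\<in>UNIV. \<mu> i *\<^sub>R g i)"
proof -
  define m where "m y = (MAX i. f i y)" for y
  define A where "A = {i. f i x = m x}"
  have le: "f i y \<le> m y" for i y unfolding m_def by simp
  have attained: "\<exists>i. m y = f i y" for y
  proof -
    have "m y \<in> range (\<lambda>i. f i y)" unfolding m_def by (rule Max_in) auto
    then show ?thesis by auto
  qed
  have "v \<in> convex hull (g ` A)"
  proof (rule ccontr)
    assume "v \<notin> convex hull (g ` A)"
    moreover have "closed (convex hull (g ` A))"
      by (intro compact_imp_closed compact_convex_hull finite_imp_compact) auto
    ultimately obtain a b where ab: "a \<bullet> v < b" "\<And>y. y \<in> convex hull (g ` A) \<Longrightarrow> b < a \<bullet> y"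
      using separating_hyperplane_closed_point[OF convex_convex_hull] by blast
    define h where "h = - a"
    define e where "e = (b - a \<bullet> v) / 2"
    have e: "e > 0" using ab(1) by (simp add: e_def)
    have gh: "g i \<bullet> h < v \<bullet> h - 2 * e" if "i \<in> A" for i
      using ab(2)[of "g i"] that by (simp add: h_def e_def inner_commute hull_inc field_simps)
    have "A \<noteq> {}" using attained[of x] by (auto simp: A_def)
    then have h: "h \<noteq> 0" using gh e by auto
    have "\<forall>\<^sub>F t in at_right (0::real). f i (x + t *\<^sub>R h) \<le> m x + t * (v \<bullet> h - e)" for i
    proof (cases "i \<in> A")
      case True
      have "((\<lambda>t. f i (x + t *\<^sub>R h)) has_derivative (\<lambda>t. g i \<bullet> (t *\<^sub>R h))) (at 0)"
        by (rule has_derivative_compose[of "\<lambda>t. x + t *\<^sub>R h" "\<lambda>t. t *\<^sub>R h" 0 UNIV "f i" "\<lambda>h. g i \<bullet> h"])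
           (auto intro!: derivative_eq_intros deriv)
      then have "((\<lambda>t. f i (x + t *\<^sub>R h)) has_real_derivative (g i \<bullet> h)) (at 0)"
        by (simp add: has_field_derivative_def mult_commute_abs)
      then have "((\<lambda>t. (f i (x + t *\<^sub>R h) - f i x) / t) \<longlongrightarrow> g i \<bullet> h) (at_right 0)"
        using filterlim_mono[OF _ order.refl at_within_le_at]
        by (force simp: DERIV_def)
      moreover have "g i \<bullet> h < v \<bullet> h - e" using gh[OF True] e by simp
      ultimately have "\<forall>\<^sub>F t in at_right 0. (f i (x + t *\<^sub>R h) - f i x) / t < v \<bullet> h - e"
        by (rule order_tendstoD)
      with eventually_at_right_less[of 0] show ?thesis
      proof eventually_elim
        case (elim t)
        then have "f i (x + t *\<^sub>R h) - f i x < (v \<bullet> h - e) * t" by (simp add: pos_divide_less_eq)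
        then show ?case using True by (simp add: A_def mult.commute)
      qed
    next
      case False
      then have lt: "f i x < m x" using le[of i x] by (simp add: A_def)
      have "isCont (f i) x" using deriv by (rule has_derivative_continuous)
      then have "((\<lambda>t. m x + t * (v \<bullet> h - e) - f i (x + t *\<^sub>R h)) \<longlongrightarrow> m x - f i x) (at_right 0)"
        by (auto intro!: tendsto_eq_intros isCont_tendsto_compose[of _ "f i"])
      from order_tendstoD(1)[OF this, of 0] lt show ?thesis
        by (auto elim: eventually_mono)
    qed
    then have "\<forall>\<^sub>F t in at_right 0. \<forall>i. f i (x + t *\<^sub>R h) \<le> m x + t * (v \<bullet> h - e)"
      by (simp add: eventually_all_finite)
    moreover have "\<forall>\<^sub>F t in at_right 0. m (x + t *\<^sub>R h) > m x + t * (v \<bullet> h - e)"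
      using frechet_subgradient_along_ray[OF v h e] by (simp add: m_def)
    ultimately have "\<forall>\<^sub>F t in at_right (0::real). False"
    proof eventually_elim
      case (elim t)
      obtain i where "m (x + t *\<^sub>R h) = f i (x + t *\<^sub>R h)" using attained by blast
      with elim show ?case by (simp add: not_less[symmetric])
    qed
    then show False by simp
  qed
  then obtain c where c: "\<And>y. y \<in> g ` A \<Longrightarrow> 0 \<le> c y" "sum c (g ` A) = 1"
      "(\<Sum>y\<in>g ` A. c y *\<^sub>R y) = v"
    unfolding convex_hull_finite[OF finite_imageI[OF finite]] by blast
  \<comment> \<open>Different active indices may have the same gradient: its weight is given to one of them.\<close>
  obtain B where B: "B \<subseteq> A" "inj_on g B" "g ` A = g ` B"
    using subset_image_inj[of "g ` A" g A] by auto
  define \<mu> where "\<mu> i = (if i \<in> B then c (g i) else 0)" for i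
  show thesis
  proof (rule that[of \<mu>])
    show "\<mu> i \<ge> 0" for i using c(1) B by (auto simp: \<mu>_def)
    show "sum \<mu> UNIV = 1"
      using c(2) unfolding B(3) sum.reindex[OF B(2)] by (simp add: \<mu>_def sum.If_cases)
    show "f i x = (MAX i. f i x)" if "\<mu> i \<noteq> 0" for i
      using that B by (auto simp: \<mu>_def A_def m_def split: if_splits)
    have "(\<Sum>i\<in>UNIV. \<mu> i *\<^sub>R g i) = (\<Sum>i\<in>B. c (g i) *\<^sub>R g i)"
      by (rule sum.mono_neutral_cong_right) (auto simp: \<mu>_def)
    then show "v = (\<Sum>i\<in>UNIV. \<mu> i *\<^sub>R g i)"
      using c(3) unfolding B(3) sum.reindex[OF B(2)] by simp
  qed
qed

section \<open>Limiting directions of a sequence\<close>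

lemma common_ereal_limit_subsequence:
  fixes u :: "nat \<Rightarrow> 'a::euclidean_space"
  assumes "finite L"
  shows "\<exists>r::nat \<Rightarrow> nat. strict_mono r \<and> (\<forall>l\<in>L. \<exists>c. (\<lambda>k. ereal (l \<bullet> u (r k))) \<longlonglongrightarrow> c)"
  using assms
proof induction
  case empty
  show ?case by (rule exI[of _ id]) (simp add: strict_mono_def)
next
  case (insert a L)
  then obtain r :: "nat \<Rightarrow> nat" where r: "strict_mono r"
    and lim: "\<And>l. l \<in> L \<Longrightarrow> \<exists>c. (\<lambda>k. ereal (l \<bullet> u (r k))) \<longlonglongrightarrow> c" by blast
  obtain c s where s: "strict_mono (s::nat \<Rightarrow> nat)" and c: "((\<lambda>k. ereal (a \<bullet> u (r k))) \<circ> s) \<longlonglongrightarrow> c"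
    using compact_complete_linorder[of "\<lambda>k. ereal (a \<bullet> u (r k))"] by blast
  have "\<exists>c. (\<lambda>k. ereal (l \<bullet> u ((r \<circ> s) k))) \<longlonglongrightarrow> c" if "l \<in> insert a L" for l
  proof (cases "l = a")
    case True
    then show ?thesis using c by (auto simp: o_def)
  next
    case False
    then have "l \<in> L" using that by simp
    from lim[OF this] obtain d where "(\<lambda>k. ereal (l \<bullet> u (r k))) \<longlonglongrightarrow> d" by blast
    from LIMSEQ_subseq_LIMSEQ[OF this s] show ?thesis by (auto simp: o_def)
  qed
  then show ?case using strict_mono_o[OF r s] by blast
qed

text \<open>This takes the place of the curve selection lemma: with \<open>u\<close> a sequence of logarithms, \<open>q\<close> plays the
exponents of a curve and \<open>z\<close> the logarithms of its leading coefficients. After the passage to a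
subsequence on which each \<open>l \<bullet> u\<close> has a limit, the functionals with finite limit form a
subspace \<open>V\<close> on which the limit is linear, hence given by some \<open>z\<close>; those with limit \<open>\<infinity>\<close> form a
convex set disjoint from \<open>V\<close>. A hyperplane separating \<open>V\<close> from the hull of the finitely many
relevant ones among them has to contain \<open>V\<close>, and its normal vector is \<open>q\<close>. A
sequence whose coordinates grow at several incomparable rates is covered as well, because only the
comparisons in \<open>L\<close> are recorded.\<close>

lemma tropical_limit:
  fixes u :: "nat \<Rightarrow> 'a::euclidean_space"
  assumes "finite L"
  obtains r :: "nat \<Rightarrow> nat" and q z :: 'a where "strict_mono r"
    and "\<And>l. l \<in> L \<Longrightarrow> l \<bullet> q = 0 \<Longrightarrow> (\<lambda>k. l \<bullet> u (r k)) \<longlonglongrightarrow> l \<bullet> z"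
    and "\<And>l. l \<in> L \<Longrightarrow> l \<bullet> q > 0 \<Longrightarrow> filterlim (\<lambda>k. l \<bullet> u (r k)) at_top sequentially"
    and "\<And>l. l \<in> L \<Longrightarrow> l \<bullet> q < 0 \<Longrightarrow> filterlim (\<lambda>k. l \<bullet> u (r k)) at_bot sequentially"
proof -
  obtain r :: "nat \<Rightarrow> nat" where r: "strict_mono r"
    and lim: "\<And>l. l \<in> L \<Longrightarrow> \<exists>c. (\<lambda>k. ereal (l \<bullet> u (r k))) \<longlonglongrightarrow> c"
    using common_ereal_limit_subsequence[OF assms] by blast
  define w where "w k = u (r k)" for k
  define V where "V = {l. convergent (\<lambda>k. l \<bullet> w k)}"
  define P where "P = {l. filterlim (\<lambda>k. l \<bullet> w k) at_top sequentially}"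
  have cases: "l \<in> V \<or> l \<in> P \<or> - l \<in> P" if l: "l \<in> L" for l
  proof -
    obtain c where c: "(\<lambda>k. ereal (l \<bullet> w k)) \<longlonglongrightarrow> c" using lim[OF l] by (auto simp: w_def)
    show ?thesis
    proof (cases c)
      case (real x)
      then show ?thesis using c by (auto simp: V_def convergent_def)
    next
      case PInf
      then have "l \<in> P" using c by (simp add: P_def tendsto_PInfty_eq_at_top)
      then show ?thesis by simp
    next
      case MInf
      from tendsto_uminus_ereal[OF c] have "- l \<in> P"
        by (simp add: P_def MInf tendsto_PInfty_eq_at_top flip: inner_minus_left)
      then show ?thesis by simp
    qed
  qed
  have V: "subspace V"
    unfolding V_def subspace_def
    by (auto simp: inner_add_left intro: convergent_add convergent_mult_const_iff convergent_const
        intro!: convergent_mult)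
  have P: "convex P"
    unfolding convex_def
  proof (intro ballI allI impI)
    fix a b and s t :: real assume ab: "a \<in> P" "b \<in> P" and st: "0 \<le> s" "0 \<le> t" "s + t = 1"
    have "filterlim (\<lambda>k. min (a \<bullet> w k) (b \<bullet> w k)) at_top sequentially"
      using ab unfolding P_def filterlim_at_top by (auto intro: eventually_conj)
    moreover have "min (a \<bullet> w k) (b \<bullet> w k) \<le> (s *\<^sub>R a + t *\<^sub>R b) \<bullet> w k" for k
    proof -
      have "min (a \<bullet> w k) (b \<bullet> w k) = s * min (a \<bullet> w k) (b \<bullet> w k) + t * min (a \<bullet> w k) (b \<bullet> w k)"
        using st by (simp flip: distrib_right)
      also have "\<dots> \<le> s * (a \<bullet> w k) + t * (b \<bullet> w k)"
        using st by (intro add_mono mult_left_mono) auto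
      finally show ?thesis by (simp add: inner_add_left)
    qed
    ultimately show "s *\<^sub>R a + t *\<^sub>R b \<in> P"
      unfolding P_def by (auto intro: filterlim_at_top_mono)
  qed
  have disj: "V \<inter> P = {}"
    using not_tendsto_and_filterlim_at_infinity[OF sequentially_bot] filterlim_at_top_imp_at_infinity
    unfolding V_def P_def convergent_def by blast
  obtain z where z: "\<And>l. l \<in> V \<Longrightarrow> (\<lambda>k. l \<bullet> w k) \<longlonglongrightarrow> l \<bullet> z"
  proof -
    obtain B where B: "B \<subseteq> V" "independent B" "V \<subseteq> span B" by (rule basis_exists)
    obtain g where g: "linear g" "\<And>b. b \<in> B \<Longrightarrow> g b = lim (\<lambda>k. b \<bullet> w k)"
      using linear_independent_extend[OF B(2), of "\<lambda>b. lim (\<lambda>k. b \<bullet> w k)"] by blast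
    have "(\<lambda>k. l \<bullet> w k) \<longlonglongrightarrow> g l" if "l \<in> V" for l
    proof -
      have "l \<in> span B" using B that by blast
      then show ?thesis
      proof (induction rule: span_induct_alt)
        case base
        show ?case using g(1) by (simp add: linear_0)
      next
        case (step c b y)
        have "(\<lambda>k. b \<bullet> w k) \<longlonglongrightarrow> g b"
          using B(1) g(2) step.hyps(1) by (auto simp: V_def convergent_LIMSEQ_iff)
        with step.IH show ?case
          by (auto simp: inner_add_left linear_add[OF g(1)] linear_cmul[OF g(1)] intro!: tendsto_intros)
      qed
    qed
    moreover have "g l = l \<bullet> adjoint g 1" for l
      using adjoint_works[OF g(1), of l 1] by simp
    ultimately show ?thesis using that by metis
  qed
  define T where "T = convex hull ((L \<union> uminus ` L) \<inter> P)"
  have TP: "T \<subseteq> P" unfolding T_def by (rule hull_minimal) (auto simp: P)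
  have "\<exists>q. (\<forall>l\<in>V. l \<bullet> q = 0) \<and> (\<forall>l\<in>T. l \<bullet> q > 0)"
  proof (cases "T = {}")
    case True
    then show ?thesis by (intro exI[of _ 0]) auto
  next
    case False
    have "compact T" unfolding T_def using assms by (intro compact_convex_hull finite_imp_compact) auto
    moreover have "convex T" unfolding T_def by (rule convex_convex_hull)
    ultimately obtain a b where ab: "\<And>l. l \<in> V \<Longrightarrow> a \<bullet> l < b" "\<And>l. l \<in> T \<Longrightarrow> a \<bullet> l > b"
      using separating_hyperplane_closed_compact[OF subspace_imp_convex[OF V] closed_subspace[OF V], of T]
        disj TP False by blast
    have b: "b > 0" using ab(1)[of 0] subspace_0[OF V] by simp
    \<comment> \<open>A functional that is bounded above on a subspace vanishes there.\<close>
    have "a \<bullet> l = 0" if l: "l \<in> V" for l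
    proof (rule ccontr)
      assume "a \<bullet> l \<noteq> 0"
      moreover have "(b / (a \<bullet> l)) *\<^sub>R l \<in> V" using V l by (rule subspace_mul)
      ultimately show False using ab(1)[of "(b / (a \<bullet> l)) *\<^sub>R l"] by simp
    qed
    then show ?thesis using ab(2) b by (intro exI[of _ a]) (force simp: inner_commute)
  qed
  then obtain q where qV: "\<And>l. l \<in> V \<Longrightarrow> l \<bullet> q = 0" and qT: "\<And>l. l \<in> T \<Longrightarrow> l \<bullet> q > 0" by blast
  have qP: "l \<bullet> q > 0" if "l \<in> P" "l \<in> L \<or> - l \<in> L" for l
  proof -
    have "l \<in> (L \<union> uminus ` L) \<inter> P" using that by force
    then show ?thesis by (intro qT) (simp add: T_def hull_inc)
  qed
  show thesis
  proof (rule that[OF r, of q z])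
    fix l assume l: "l \<in> L"
    show "(\<lambda>k. l \<bullet> u (r k)) \<longlonglongrightarrow> l \<bullet> z" if "l \<bullet> q = 0"
      using cases[OF l] qP[of l] qP[of "-l"] l that z[of l] by (auto simp: w_def)
    show "filterlim (\<lambda>k. l \<bullet> u (r k)) at_top sequentially" if "l \<bullet> q > 0"
      using cases[OF l] qP[of l] qP[of "-l"] l that qV[of l] by (auto simp: w_def P_def)
    show "filterlim (\<lambda>k. l \<bullet> u (r k)) at_bot sequentially" if "l \<bullet> q < 0"
      using cases[OF l] qP[of l] qP[of "-l"] l that qV[of l]
      by (auto simp: w_def P_def filterlim_uminus_at_bot)
  qed
qed

section \<open>Polynomials in logarithmic coordinates\<close>

definition monomial_eval :: "nat ^ 'n \<Rightarrow> real ^ 'n::finite \<Rightarrow> real" where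
  "monomial_eval \<kappa> x = (\<Prod>j\<in>UNIV. (x $ j) ^ (\<kappa> $ j))"

definition poly_gradient :: "'n::finite rpoly \<Rightarrow> real ^ 'n \<Rightarrow> real ^ 'n" where
  "poly_gradient g x = (\<chi> j. \<Sum>\<kappa>\<in>Poly_Mapping.keys g. Poly_Mapping.lookup g \<kappa> *
     (real (\<kappa> $ j) * (x $ j) ^ (\<kappa> $ j - 1) * (\<Prod>l\<in>UNIV - {j}. (x $ l) ^ (\<kappa> $ l))))"

definition log_abs :: "real ^ 'n \<Rightarrow> real ^ 'n::finite" where
  "log_abs x = (\<chi> j. ln \<bar>x $ j\<bar>)"

definition sign_vector :: "real ^ 'n \<Rightarrow> real ^ 'n::finite" where
  "sign_vector x = (\<chi> j. sgn (x $ j))"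

text \<open>The inverse of the passage to \<open>sign_vector\<close> and \<open>log_abs\<close> on the points with nonzero coordinates.\<close>

definition signed_exp :: "real ^ 'n \<Rightarrow> real ^ 'n \<Rightarrow> real ^ 'n::finite" where
  "signed_exp \<sigma> w = (\<chi> j. \<sigma> $ j * exp (w $ j))"

lemma poly_eval_monomials:
  "poly_eval g x = (\<Sum>\<kappa>\<in>Poly_Mapping.keys g. Poly_Mapping.lookup g \<kappa> * monomial_eval \<kappa> x)"
  by (simp add: poly_eval_def monomial_eval_def)

lemma poly_eval_has_derivative:
  "(poly_eval g has_derivative (\<lambda>h. poly_gradient g x \<bullet> h)) (at x)"
proof -
  have "(poly_eval g has_derivative (\<lambda>h. \<Sum>\<kappa>\<in>Poly_Mapping.keys g. Poly_Mapping.lookup g \<kappa> *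
      (\<Sum>j\<in>UNIV. (real (\<kappa> $ j) * h $ j * (x $ j) ^ (\<kappa> $ j - 1)) *
         (\<Prod>l\<in>UNIV - {j}. (x $ l) ^ (\<kappa> $ l))))) (at x)"
    unfolding poly_eval_def[abs_def]
    by (intro has_derivative_sum has_derivative_mult_right has_derivative_prod
        has_derivative_eq_rhs[OF has_derivative_power[OF
          bounded_linear_imp_has_derivative[OF bounded_linear_vec_nth]]])
       (simp add: fun_eq_iff mult_ac)
  moreover have "(\<Sum>\<kappa>\<in>Poly_Mapping.keys g. Poly_Mapping.lookup g \<kappa> *
      (\<Sum>j\<in>UNIV. (real (\<kappa> $ j) * h $ j * (x $ j) ^ (\<kappa> $ j - 1)) *
         (\<Prod>l\<in>UNIV - {j}. (x $ l) ^ (\<kappa> $ l)))) = poly_gradient g x \<bullet> h" for h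
    unfolding poly_gradient_def inner_vec_def sum_distrib_left
    by (subst sum.swap) (simp add: sum_distrib_left sum_distrib_right mult_ac)
  ultimately show ?thesis by (simp only:)
qed

lemma partial_deriv_poly_eval: "partial_deriv j (poly_eval g) x = poly_gradient g x $ j"
  unfolding partial_deriv_def frechet_derivative_at[OF poly_eval_has_derivative, symmetric]
  by (simp add: inner_axis)

text \<open>The logarithmic derivative \<open>x\<^sub>j \<partial>\<^sub>j\<close> acts diagonally on monomials, so values and logarithmic
derivatives of a polynomial are both combinations of the same monomials, and one limit lemma
serves for both.\<close>

lemma coordinate_times_poly_gradient:
  "x $ j * poly_gradient g x $ j =
     (\<Sum>\<kappa>\<in>Poly_Mapping.keys g. Poly_Mapping.lookup g \<kappa> * real (\<kappa> $ j) * monomial_eval \<kappa> x)"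
proof -
  have "x $ j * (real (\<kappa> $ j) * (x $ j) ^ (\<kappa> $ j - 1) * (\<Prod>l\<in>UNIV - {j}. (x $ l) ^ (\<kappa> $ l)))
      = real (\<kappa> $ j) * monomial_eval \<kappa> x" for \<kappa> :: "nat ^ 'a"
    unfolding monomial_eval_def prod.remove[OF finite UNIV_I, of _ j]
    by (cases "\<kappa> $ j") auto
  then show ?thesis
    unfolding poly_gradient_def vec_lambda_beta sum_distrib_left
    by (intro sum.cong refl) (simp add: mult_ac)
qed

lemma continuous_poly_gradient: "isCont (poly_gradient g) x"
  unfolding poly_gradient_def[abs_def] isCont_def by (intro tendsto_vec_lambda tendsto_intros)

lemma monomial_eval_signed_exp:
  "monomial_eval \<kappa> (signed_exp \<sigma> w) = monomial_eval \<kappa> \<sigma> * exp (exponent_point \<kappa> \<bullet> w)"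
  by (simp add: monomial_eval_def signed_exp_def exponent_point_def inner_vec_def power_mult_distrib
      prod.distrib exp_sum exp_of_nat_mult)

lemma signed_exp_log_abs: "(\<And>j. x $ j \<noteq> 0) \<Longrightarrow> signed_exp (sign_vector x) (log_abs x) = x"
  by (simp add: signed_exp_def sign_vector_def log_abs_def vec_eq_iff mult_sgn_abs)

text \<open>If \<open>d\<close> is the maximal degree and \<open>\<kappa>0\<close> an exponent attaining it, then relative to \<open>\<kappa>0\<close> exactly the
monomials of degree \<open>d\<close> survive in the limit, as the last hypothesis says. They converge to their
values at the point with signs \<open>\<sigma>\<close> and logarithms \<open>z\<close>. The coefficients
\<open>a\<close> are arbitrary so that logarithmic derivatives are covered.\<close>

lemma leading_form_limit:
  fixes x :: "nat \<Rightarrow> real ^ 'n::finite"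
  assumes nz: "\<And>k j. x k $ j \<noteq> 0"
    and \<sigma>: "(\<lambda>k. sign_vector (x k)) \<longlonglongrightarrow> \<sigma>"
    and K: "finite K"
    and lim: "\<And>\<kappa>. \<kappa> \<in> K \<Longrightarrow>
      (\<lambda>k. exp ((exponent_point \<kappa> - \<kappa>0) \<bullet> log_abs (x k))) \<longlonglongrightarrow>
        (if q \<bullet> exponent_point \<kappa> = d then exp ((exponent_point \<kappa> - \<kappa>0) \<bullet> z) else 0)"
  shows "(\<lambda>k. (\<Sum>\<kappa>\<in>K. a \<kappa> * monomial_eval \<kappa> (x k)) / exp (\<kappa>0 \<bullet> log_abs (x k))) \<longlonglongrightarrow>
    (\<Sum>\<kappa> | \<kappa> \<in> K \<and> q \<bullet> exponent_point \<kappa> = d. a \<kappa> * monomial_eval \<kappa> (signed_exp \<sigma> z)) / exp (\<kappa>0 \<bullet> z)"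
proof -
  have "(\<lambda>k. \<Sum>\<kappa>\<in>K. a \<kappa> * monomial_eval \<kappa> (sign_vector (x k)) *
        exp ((exponent_point \<kappa> - \<kappa>0) \<bullet> log_abs (x k))) \<longlonglongrightarrow>
      (\<Sum>\<kappa>\<in>K. a \<kappa> * monomial_eval \<kappa> \<sigma> *
        (if q \<bullet> exponent_point \<kappa> = d then exp ((exponent_point \<kappa> - \<kappa>0) \<bullet> z) else 0))"
    unfolding monomial_eval_def by (intro tendsto_intros lim \<sigma>)
  moreover have "(\<Sum>\<kappa>\<in>K. a \<kappa> * monomial_eval \<kappa> (sign_vector (x k)) *
        exp ((exponent_point \<kappa> - \<kappa>0) \<bullet> log_abs (x k))) =
      (\<Sum>\<kappa>\<in>K. a \<kappa> * monomial_eval \<kappa> (x k)) / exp (\<kappa>0 \<bullet> log_abs (x k))" for k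
  proof -
    have "monomial_eval \<kappa> (x k) =
        monomial_eval \<kappa> (sign_vector (x k)) * exp (exponent_point \<kappa> \<bullet> log_abs (x k))" for \<kappa>
      using monomial_eval_signed_exp[of \<kappa> "sign_vector (x k)" "log_abs (x k)"]
      by (simp add: signed_exp_log_abs nz)
    then show ?thesis by (simp add: sum_divide_distrib inner_diff_left exp_diff mult_ac)
  qed
  moreover have "(\<Sum>\<kappa>\<in>K. a \<kappa> * monomial_eval \<kappa> \<sigma> *
        (if q \<bullet> exponent_point \<kappa> = d then exp ((exponent_point \<kappa> - \<kappa>0) \<bullet> z) else 0)) =
      (\<Sum>\<kappa> | \<kappa> \<in> K \<and> q \<bullet> exponent_point \<kappa> = d. a \<kappa> * monomial_eval \<kappa> (signed_exp \<sigma> z)) / exp (\<kappa>0 \<bullet> z)"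
    unfolding sum_divide_distrib
    by (rule sum.mono_neutral_cong_right)
       (auto simp: K monomial_eval_signed_exp inner_diff_left exp_diff)
  ultimately show ?thesis by simp
qed

section \<open>Faces of Newton polyhedra\<close>

lemma lookup_face_part:
  "Poly_Mapping.lookup (face_part g \<Delta>) \<kappa> =
     (if exponent_point \<kappa> \<in> \<Delta> then Poly_Mapping.lookup g \<kappa> else 0)"
  unfolding face_part_def lookup_sum lookup_single when_def
  by (auto simp: sum.delta in_keys_iff)

lemma keys_face_part:
  "Poly_Mapping.keys (face_part g \<Delta>) = {\<kappa> \<in> Poly_Mapping.keys g. exponent_point \<kappa> \<in> \<Delta>}"
  by (auto simp: in_keys_iff lookup_face_part split: if_splits)

lemma support_min_attained:
  assumes "compact \<Gamma>" "\<Gamma> \<noteq> {}"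
  shows "\<exists>a\<in>\<Gamma>. q \<bullet> a = support_min q \<Gamma>"
    and "x \<in> \<Gamma> \<Longrightarrow> support_min q \<Gamma> \<le> q \<bullet> x"
proof -
  have "continuous_on \<Gamma> (\<lambda>x. q \<bullet> x)" by (intro continuous_intros)
  then obtain a where a: "a \<in> \<Gamma>" "\<And>x. x \<in> \<Gamma> \<Longrightarrow> q \<bullet> a \<le> q \<bullet> x"
    using continuous_attains_inf[OF assms] by blast
  have "support_min q \<Gamma> = q \<bullet> a"
    unfolding support_min_def using a by (intro cInf_eq_minimum) auto
  with a show "\<exists>a\<in>\<Gamma>. q \<bullet> a = support_min q \<Gamma>"
    and "x \<in> \<Gamma> \<Longrightarrow> support_min q \<Gamma> \<le> q \<bullet> x" by auto
qed

text \<open>A sum of points attains the minimum of \<open>q\<close> over a Minkowski sum exactly when each summand attains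
its own minimum, since no summand can fall below it.\<close>

lemma face_at_set_sum:
  fixes \<Gamma> :: "'p::finite \<Rightarrow> (real ^ 'n::finite) set"
  assumes comp: "\<And>i. compact (\<Gamma> i)" and ne: "\<And>i. \<Gamma> i \<noteq> {}"
  shows "support_min q (\<Sum>i\<in>UNIV. \<Gamma> i) = (\<Sum>i\<in>UNIV. support_min q (\<Gamma> i))"
    and "face_at q (\<Sum>i\<in>UNIV. \<Gamma> i) = (\<Sum>i\<in>UNIV. face_at q (\<Gamma> i))"
proof -
  let ?m = "\<lambda>i. support_min q (\<Gamma> i)"
  have "\<forall>i. \<exists>a. a \<in> \<Gamma> i \<and> q \<bullet> a = ?m i"
    using support_min_attained(1)[OF comp ne, where q = q] by blast
  then obtain a where a: "\<And>i. a i \<in> \<Gamma> i" "\<And>i. q \<bullet> a i = ?m i"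
    by (auto dest!: choice)
  have ge: "q \<bullet> x \<ge> ?m i" if "x \<in> \<Gamma> i" for x i
    using support_min_attained(2)[OF comp ne that] .
  show eq: "support_min q (\<Sum>i\<in>UNIV. \<Gamma> i) = (\<Sum>i\<in>UNIV. ?m i)"
    unfolding support_min_def[of q "\<Sum>i\<in>UNIV. \<Gamma> i"]
  proof (rule cInf_eq_minimum)
    have "(\<Sum>i\<in>UNIV. a i) \<in> (\<Sum>i\<in>UNIV. \<Gamma> i)" using a(1) by (auto simp: set_sum_alt)
    then show "(\<Sum>i\<in>UNIV. ?m i) \<in> (\<bullet>) q ` (\<Sum>i\<in>UNIV. \<Gamma> i)"
      using a(2) by (intro image_eqI[of _ _ "\<Sum>i\<in>UNIV. a i"]) (auto simp: inner_sum_right)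
  next
    fix t assume "t \<in> (\<bullet>) q ` (\<Sum>i\<in>UNIV. \<Gamma> i)"
    then obtain s where "\<And>i. s i \<in> \<Gamma> i" "t = q \<bullet> (\<Sum>i\<in>UNIV. s i)" by (auto simp: set_sum_alt)
    then show "(\<Sum>i\<in>UNIV. ?m i) \<le> t" by (auto simp: inner_sum_right intro: sum_mono ge)
  qed
  have iff: "q \<bullet> (\<Sum>i\<in>UNIV. s i) = (\<Sum>i\<in>UNIV. ?m i) \<longleftrightarrow> (\<forall>i. q \<bullet> s i = ?m i)"
    if "\<And>i. s i \<in> \<Gamma> i" for s
    using sum_mono_inv[of ?m UNIV "\<lambda>i. q \<bullet> s i"] ge that by (force simp: inner_sum_right)
  show "face_at q (\<Sum>i\<in>UNIV. \<Gamma> i) = (\<Sum>i\<in>UNIV. face_at q (\<Gamma> i))"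
  proof (intro set_eqI iffI)
    fix v assume "v \<in> face_at q (\<Sum>i\<in>UNIV. \<Gamma> i)"
    then have "v \<in> (\<Sum>i\<in>UNIV. \<Gamma> i)" and v: "q \<bullet> v = (\<Sum>i\<in>UNIV. ?m i)"
      by (auto simp: face_at_def eq)
    then obtain s where s: "\<And>i. s i \<in> \<Gamma> i" "v = (\<Sum>i\<in>UNIV. s i)" by (auto simp: set_sum_alt)
    with iff[of s] v have "\<And>i. s i \<in> face_at q (\<Gamma> i)" by (auto simp: face_at_def)
    with s(2) show "v \<in> (\<Sum>i\<in>UNIV. face_at q (\<Gamma> i))" by (auto simp: set_sum_alt)
  next
    fix v assume "v \<in> (\<Sum>i\<in>UNIV. face_at q (\<Gamma> i))"
    then obtain s where s: "\<And>i. s i \<in> face_at q (\<Gamma> i)" "v = (\<Sum>i\<in>UNIV. s i)"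
      by (auto simp: set_sum_alt)
    then have s': "\<And>i. s i \<in> \<Gamma> i" "\<forall>i. q \<bullet> s i = ?m i" by (auto simp: face_at_def)
    with s(2) have "v \<in> (\<Sum>i\<in>UNIV. \<Gamma> i)" by (auto simp: set_sum_alt)
    with iff[of s] s' s(2) show "v \<in> face_at q (\<Sum>i\<in>UNIV. \<Gamma> i)" by (simp add: face_at_def eq)
  qed
qed

lemma newton_polyhedron_le:
  assumes "\<And>\<kappa>. \<kappa> \<in> Poly_Mapping.keys g \<Longrightarrow> q \<bullet> exponent_point \<kappa> \<le> d" "0 \<le> d"
    and "x \<in> newton_polyhedron g"
  shows "q \<bullet> x \<le> d"
proof -
  have "convex hull (exponent_point ` Poly_Mapping.keys g \<union> {0}) \<subseteq> {x. q \<bullet> x \<le> d}"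
    using assms(1,2) by (intro hull_minimal convex_halfspace_le) auto
  then show ?thesis using assms(3) by (auto simp: newton_polyhedron_def split: if_splits)
qed

lemma exponent_in_newton_polyhedron:
  "\<kappa> \<in> Poly_Mapping.keys g \<Longrightarrow> exponent_point \<kappa> \<in> newton_polyhedron g"
  by (auto simp: newton_polyhedron_def intro: hull_inc)

lemma compact_newton_polyhedron: "compact (newton_polyhedron g)"
  by (simp add: newton_polyhedron_def finite_imp_compact_convex_hull)

text \<open>Faces are defined by minimizing, growth along a sequence is governed by maximizing: hence the sign.
The degree has to be nonnegative because the origin belongs to the polyhedron.\<close>

lemma support_min_newton_polyhedron:
  assumes "\<And>\<kappa>. \<kappa> \<in> Poly_Mapping.keys g \<Longrightarrow> q \<bullet> exponent_point \<kappa> \<le> q \<bullet> exponent_point \<kappa>0"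
    and "\<kappa>0 \<in> Poly_Mapping.keys g" "0 \<le> q \<bullet> exponent_point \<kappa>0"
  shows "support_min (- q) (newton_polyhedron g) = - (q \<bullet> exponent_point \<kappa>0)"
  unfolding support_min_def
  using newton_polyhedron_le[of g q] exponent_in_newton_polyhedron[of \<kappa>0 g] assms
  by (intro cInf_eq_minimum) force+

lemma convenient_nonempty: "convenient g \<Longrightarrow> newton_polyhedron g \<noteq> {}"
  unfolding convenient_def by blast

text \<open>A point \<open>m e\<^sub>j\<close> of the polyhedron has \<open>q\<close>-degree \<open>m q\<^sub>j \<ge> q\<^sub>j\<close>, and a linear form on a convex
hull does not exceed its maximum on the generators; the generator \<open>0\<close> is excluded by \<open>q\<^sub>j > 0\<close>.\<close>

lemma convenient_exponent_ge:
  fixes g :: "'n::finite rpoly"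
  assumes conv: "convenient g" and q: "q $ j > 0"
  obtains \<kappa> where "\<kappa> \<in> Poly_Mapping.keys g" "q \<bullet> exponent_point \<kappa> \<ge> q $ j"
proof (rule ccontr)
  assume neg: "\<not> thesis"
  have g: "g \<noteq> 0" using convenient_nonempty[OF conv] by (auto simp: newton_polyhedron_def)
  obtain m :: nat where m: "m > 0" "real m *\<^sub>R axis j 1 \<in> newton_polyhedron g"
    using conv by (auto simp: convenient_def)
  have "convex hull (exponent_point ` Poly_Mapping.keys g \<union> {0}) \<subseteq> {x. q \<bullet> x < q $ j}"
    using neg that q by (intro hull_minimal convex_halfspace_lt) (auto simp: not_le[symmetric])
  then have "real m * q $ j < q $ j"
    using m(2) g by (auto simp: newton_polyhedron_def inner_axis)
  moreover have "1 * q $ j \<le> real m * q $ j" using m(1) q by (intro mult_right_mono) auto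
  ultimately show False by simp
qed

section \<open>Nondegeneracy excludes critical sequences at infinity\<close>

text \<open>Here \<open>E s k\<close> is the size of the generalized monomial with exponent \<open>s\<close> in the quantities \<open>\<bar>x\<^sub>j\<bar>\<close> and
\<open>\<mu>\<^sub>i\<close>. The set \<open>S\<close> contains all those that have to be compared: the constant \<open>1\<close>, the variables
and multipliers, and the monomials of each \<open>f\<^sub>i\<close>, alone or times a multiplier. The hypotheses
\<open>lim_le\<close> and \<open>lim_gt\<close> say that \<open>(qx, q\<mu>)\<close> decides every comparison. The number \<open>f k\<close> may be any
common comparison value, such as \<open>max\<^sub>i f\<^sub>i (x k)\<close>.\<close>

lemma degenerate_limit_contradiction:
  fixes F :: "'p::finite \<Rightarrow> 'n::finite rpoly"
    and x :: "nat \<Rightarrow> real ^ 'n" and \<mu> :: "nat \<Rightarrow> real ^ 'p" and f :: "nat \<Rightarrow> real"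
    and qx zx :: "real ^ 'n" and q\<mu> z\<mu> :: "real ^ 'p"
  defines "E \<equiv> \<lambda>s k. exp (s \<bullet> (log_abs (x k), \<chi> i. ln (\<mu> k $ i)))"
  assumes conv: "convenient_map F"
    and nondeg: "nondegenerate_at_infinity F"
    and nz: "\<And>k j. x k $ j \<noteq> 0"
    and \<mu>_pos: "\<And>k i. \<mu> k $ i > 0"
    and \<mu>_sum: "\<And>k. (\<Sum>i\<in>UNIV. \<mu> k $ i) \<ge> 1"
    and unbounded: "filterlim (\<lambda>k. norm (x k)) at_top sequentially"
    and critical: "(\<lambda>k. \<Sum>i\<in>UNIV. \<mu> k $ i *\<^sub>R poly_gradient (F i) (x k)) \<longlonglongrightarrow> 0"
    and complementary: "\<And>i. (\<lambda>k. \<mu> k $ i * (poly_eval (F i) (x k) - f k)) \<longlonglongrightarrow> 0"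
    and signs: "(\<lambda>k. sign_vector (x k)) \<longlonglongrightarrow> \<sigma>"
    and S: "0 \<in> S" "\<And>j. (axis j 1, 0) \<in> S" "\<And>i. (0, axis i 1) \<in> S"
      "\<And>i \<kappa>. \<kappa> \<in> Poly_Mapping.keys (F i) \<Longrightarrow> (exponent_point \<kappa>, 0) \<in> S"
      "\<And>i \<kappa>. \<kappa> \<in> Poly_Mapping.keys (F i) \<Longrightarrow> (exponent_point \<kappa>, axis i 1) \<in> S"
    and lim_le: "\<And>s s'. s \<in> S \<Longrightarrow> s' \<in> S \<Longrightarrow> s \<bullet> (qx, q\<mu>) \<le> s' \<bullet> (qx, q\<mu>) \<Longrightarrow>
      (\<lambda>k. E s k / E s' k) \<longlonglongrightarrow> (if s \<bullet> (qx, q\<mu>) = s' \<bullet> (qx, q\<mu>) then exp ((s - s') \<bullet> (zx, z\<mu>)) else 0)"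
    and lim_gt: "\<And>s s'. s \<in> S \<Longrightarrow> s' \<in> S \<Longrightarrow> s \<bullet> (qx, q\<mu>) > s' \<bullet> (qx, q\<mu>) \<Longrightarrow>
      filterlim (\<lambda>k. E s k / E s' k) at_top sequentially"
  shows False
proof -
  have E_0: "E 0 k = 1" for k by (simp add: E_def)
  have E_axis: "E (axis j 1, 0) k = \<bar>x k $ j\<bar>" for j k
    using nz by (simp add: E_def inner_axis' log_abs_def)
  have E_\<mu>: "E (0, axis i 1) k = \<mu> k $ i" for i k
    using \<mu>_pos by (simp add: E_def inner_axis')
  have E_pair: "E (p, axis i 1) k = E (p, 0) k * \<mu> k $ i" for p i k
    using \<mu>_pos by (simp add: E_def inner_axis' exp_add)
  have E_pos: "E s k > 0" for s k by (simp add: E_def)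
  \<comment> \<open>Since the sequence is unbounded, some coordinate has positive degree.\<close>
  obtain j0 where j0: "qx $ j0 > 0"
  proof (rule ccontr)
    assume "\<not> thesis"
    then have neg: "qx $ j \<le> 0" for j using that not_less by blast
    have "\<exists>l. (\<lambda>k. \<bar>x k $ j\<bar>) \<longlonglongrightarrow> l" for j
      using lim_le[of "(axis j 1, 0)" 0] S neg[of j] by (auto simp: E_0 E_axis inner_axis')
    then obtain l where "\<And>j. (\<lambda>k. \<bar>x k $ j\<bar>) \<longlonglongrightarrow> l j" by metis
    then have "(\<lambda>k. \<Sum>j\<in>UNIV. \<bar>x k $ j\<bar>) \<longlonglongrightarrow> (\<Sum>j\<in>UNIV. l j)" by (intro tendsto_sum)
    moreover have "filterlim (\<lambda>k. \<Sum>j\<in>UNIV. \<bar>x k $ j\<bar>) at_top sequentially"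
      using unbounded by (rule filterlim_at_top_mono) (simp add: norm_le_l1_cart)
    ultimately show False
      using not_tendsto_and_filterlim_at_infinity[OF sequentially_bot] filterlim_at_top_imp_at_infinity
      by blast
  qed
  \<comment> \<open>The multipliers have total mass at least \<open>1\<close>, so not all of them tend to zero.\<close>
  obtain i1 where i1: "q\<mu> $ i1 \<ge> 0"
  proof (rule ccontr)
    assume "\<not> thesis"
    then have neg: "q\<mu> $ i < 0" for i using that not_less by blast
    have "(\<lambda>k. \<mu> k $ i) \<longlonglongrightarrow> 0" for i
      using lim_le[of "(0, axis i 1)" 0] S neg[of i] by (auto simp: E_0 E_\<mu> inner_axis')
    then have "(\<lambda>k. \<Sum>i\<in>UNIV. \<mu> k $ i) \<longlonglongrightarrow> (\<Sum>i\<in>(UNIV::'p set). 0)" by (intro tendsto_sum)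
    from LIMSEQ_le_const[OF this, of 1] \<mu>_sum show False by auto
  qed
  have ge: "\<exists>\<kappa>\<in>Poly_Mapping.keys (F i). qx \<bullet> exponent_point \<kappa> \<ge> qx $ j" if "qx $ j > 0" for i j
    using convenient_exponent_ge[of "F i" qx j] conv that unfolding convenient_map_def by blast
  have "\<exists>\<kappa>\<in>Poly_Mapping.keys (F i). \<forall>\<kappa>'\<in>Poly_Mapping.keys (F i).
      qx \<bullet> exponent_point \<kappa>' \<le> qx \<bullet> exponent_point \<kappa>" for i
  proof -
    have "Poly_Mapping.keys (F i) \<noteq> {}" using ge[OF j0, of i] by blast
    from ex_is_arg_min_if_finite[OF finite_keys this, of "\<lambda>\<kappa>. - (qx \<bullet> exponent_point \<kappa>)"]
    show ?thesis unfolding is_arg_min_linorder by auto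
  qed
  then obtain \<kappa> where \<kappa>: "\<And>i. \<kappa> i \<in> Poly_Mapping.keys (F i)"
    and \<kappa>_max: "\<And>i \<kappa>'. \<kappa>' \<in> Poly_Mapping.keys (F i) \<Longrightarrow>
      qx \<bullet> exponent_point \<kappa>' \<le> qx \<bullet> exponent_point (\<kappa> i)"
    by metis
  define d where "d i = qx \<bullet> exponent_point (\<kappa> i)" for i
  have d_ge: "qx $ j \<le> d i" if "qx $ j > 0" for i j
    using ge[OF that, of i] \<kappa>_max unfolding d_def by force
  have d_pos: "d i > 0" for i using d_ge[OF j0, of i] j0 by simp
  \<comment> \<open>\<open>D i\<close> is the degree of \<open>\<mu>\<^sub>i\<close> times the dominant monomial of \<open>f\<^sub>i\<close>.\<close>
  define D where "D i = d i + q\<mu> $ i" for i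
  obtain i0 where i0: "\<And>i. D i \<le> D i0"
    using ex_is_arg_min_if_finite[of "UNIV :: 'p set" "\<lambda>i. - D i"] by (auto simp: is_arg_min_linorder)
  have D_ge: "d i1 \<le> D i0" using i0[of i1] i1 by (simp add: D_def)
  have D_pos: "D i0 > 0" using D_ge d_pos[of i1] by simp
  \<comment> \<open>This is what makes \<open>x\<^sub>j\<close> times a vanishing gradient negligible against the size \<open>N\<close> below.\<close>
  have D_ge_q: "qx $ j \<le> D i0" for j
    using d_ge[of j i1] D_ge D_pos by linarith
  define s where "s i = (exponent_point (\<kappa> i), axis i (1::real))" for i
  have sS: "s i \<in> S" for i unfolding s_def using S(5) \<kappa> by blast
  have sq: "s i \<bullet> (qx, q\<mu>) = D i" for i
    by (simp add: s_def D_def d_def inner_axis' inner_commute[of qx])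
  define M where "M i k = E (exponent_point (\<kappa> i), 0) k" for i k
  define N where "N k = E (s i0) k" for k
  define w where "w i k = M i k * \<mu> k $ i / N k" for i k
  \<comment> \<open>The limit of \<open>w i\<close>; it is positive exactly for the indices of maximal degree \<open>D\<close>.\<close>
  define c where "c i = (if D i = D i0 then exp ((s i - s i0) \<bullet> (zx, z\<mu>)) else 0)" for i
  have M_pos: "M i k > 0" and N_pos: "N k > 0" for i k by (simp_all add: M_def N_def E_pos)
  have M_exp: "M i k = exp (exponent_point (\<kappa> i) \<bullet> log_abs (x k))" for i k
    by (simp add: M_def E_def)
  have c_nonneg: "c i \<ge> 0" for i by (simp add: c_def)
  have w: "w i \<longlonglongrightarrow> c i" for i
  proof -
    have "w i = (\<lambda>k. E (s i) k / E (s i0) k)"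
      by (simp add: fun_eq_iff w_def N_def M_def s_def E_pair)
    then show ?thesis
      using lim_le[OF sS[of i] sS[of i0]] by (simp add: sq i0 c_def)
  qed
  have N_top: "filterlim N at_top sequentially"
    using lim_gt[OF sS[of i0] S(1)] D_pos by (simp add: sq N_def[abs_def] E_0)
  define y where "y = signed_exp \<sigma> zx"
  define \<Delta> where "\<Delta> i = face_at (- qx) (newton_polyhedron (F i))" for i
  define G where "G i = face_part (F i) (\<Delta> i)" for i
  have supp_min: "support_min (- qx) (newton_polyhedron (F i)) = - d i" for i
    unfolding d_def using \<kappa> \<kappa>_max d_pos[of i] by (intro support_min_newton_polyhedron) (auto simp: d_def)
  have keys_G: "Poly_Mapping.keys (G i) =
      {\<kappa> \<in> Poly_Mapping.keys (F i). qx \<bullet> exponent_point \<kappa> = d i}" for i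
    unfolding G_def keys_face_part \<Delta>_def face_at_def supp_min
    using exponent_in_newton_polyhedron by auto
  have lookup_G: "Poly_Mapping.lookup (G i) \<kappa>' = Poly_Mapping.lookup (F i) \<kappa>'"
    if "\<kappa>' \<in> Poly_Mapping.keys (G i)" for i \<kappa>'
    using that unfolding G_def lookup_face_part keys_face_part by auto
  define A where "A i = poly_eval (G i) y / exp (exponent_point (\<kappa> i) \<bullet> zx)" for i
  define B where "B i j = y $ j * poly_gradient (G i) y $ j / exp (exponent_point (\<kappa> i) \<bullet> zx)" for i j
  have monomial_lim: "(\<lambda>k. exp ((exponent_point \<kappa>' - exponent_point (\<kappa> i)) \<bullet> log_abs (x k))) \<longlonglongrightarrow>
      (if qx \<bullet> exponent_point \<kappa>' = d i then exp ((exponent_point \<kappa>' - exponent_point (\<kappa> i)) \<bullet> zx) else 0)"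
    if "\<kappa>' \<in> Poly_Mapping.keys (F i)" for i \<kappa>'
  proof -
    have "((p, 0) - (p', 0)) \<bullet> (zx, z\<mu>) = (p - p') \<bullet> zx" for p p' by simp
    then show ?thesis
      using lim_le[OF S(4)[OF that] S(4)[OF \<kappa>[of i]]] \<kappa>_max[OF that]
      by (simp only:) (simp add: d_def inner_commute[of qx] E_def inner_diff_left flip: exp_diff)
  qed
  have A: "(\<lambda>k. poly_eval (F i) (x k) / M i k) \<longlonglongrightarrow> A i" for i
    using leading_form_limit[OF nz signs finite_keys[of "F i"] monomial_lim, of i "Poly_Mapping.lookup (F i)"]
    by (simp add: poly_eval_monomials A_def M_exp keys_G lookup_G flip: y_def)
  have B: "(\<lambda>k. x k $ j * poly_gradient (F i) (x k) $ j / M i k) \<longlonglongrightarrow> B i j" for i j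
    using leading_form_limit[OF nz signs finite_keys[of "F i"] monomial_lim, of i
        "\<lambda>\<kappa>. Poly_Mapping.lookup (F i) \<kappa> * real (\<kappa> $ j)"]
    by (simp add: coordinate_times_poly_gradient B_def M_exp keys_G lookup_G flip: y_def)
  have sum_cB: "(\<Sum>i\<in>UNIV. c i * B i j) = 0" for j
  proof -
    define g where "g k = (\<Sum>i\<in>UNIV. \<mu> k $ i *\<^sub>R poly_gradient (F i) (x k))" for k
    obtain l where "(\<lambda>k. \<bar>x k $ j\<bar> / N k) \<longlonglongrightarrow> l"
      using lim_le[OF S(2)[of j] sS[of i0]] D_ge_q[of j]
      by (auto simp: E_axis sq inner_axis' simp flip: N_def)
    moreover have "(\<lambda>k. g k $ j) \<longlonglongrightarrow> 0"
      using tendsto_vec_nth[OF critical, of j] by (simp add: g_def)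
    ultimately have "(\<lambda>k. sign_vector (x k) $ j * (\<bar>x k $ j\<bar> / N k) * g k $ j) \<longlonglongrightarrow> \<sigma> $ j * l * 0"
      by (intro tendsto_mult tendsto_vec_nth signs)
    moreover have "sign_vector (x k) $ j * (\<bar>x k $ j\<bar> / N k) * g k $ j =
        (\<Sum>i\<in>UNIV. w i k * (x k $ j * poly_gradient (F i) (x k) $ j / M i k))" for k
    proof -
      have "sign_vector (x k) $ j * (\<bar>x k $ j\<bar> / N k) * g k $ j = x k $ j * g k $ j / N k"
        by (simp add: sign_vector_def sgn_mult_abs)
      also have "\<dots> = (\<Sum>i\<in>UNIV. w i k * (x k $ j * poly_gradient (F i) (x k) $ j / M i k))"
        unfolding g_def sum_component sum_distrib_left sum_divide_distrib
        using M_pos by (intro sum.cong refl) (simp add: w_def less_imp_neq[symmetric] mult_ac)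
      finally show ?thesis .
    qed
    moreover have "(\<lambda>k. \<Sum>i\<in>UNIV. w i k * (x k $ j * poly_gradient (F i) (x k) $ j / M i k)) \<longlonglongrightarrow>
        (\<Sum>i\<in>UNIV. c i * B i j)"
      by (intro tendsto_sum tendsto_mult w B)
    ultimately show ?thesis using LIMSEQ_unique by fastforce
  qed
  \<comment> \<open>Euler's identity: all monomials of \<open>G i\<close> have the same degree \<open>d i\<close> for the weights \<open>qx\<close>.\<close>
  have euler: "(\<Sum>j\<in>UNIV. qx $ j * B i j) = d i * A i" for i
  proof -
    have "(\<Sum>j\<in>UNIV. qx $ j * (y $ j * poly_gradient (G i) y $ j)) =
        (\<Sum>\<kappa>'\<in>Poly_Mapping.keys (G i). (qx \<bullet> exponent_point \<kappa>') *
          (Poly_Mapping.lookup (G i) \<kappa>' * monomial_eval \<kappa>' y))"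
      unfolding coordinate_times_poly_gradient sum_distrib_left inner_vec_def sum_distrib_right
      by (subst sum.swap) (simp add: exponent_point_def mult_ac)
    also have "\<dots> = d i * poly_eval (G i) y"
      unfolding poly_eval_monomials sum_distrib_left by (intro sum.cong refl) (auto simp: keys_G)
    finally show ?thesis by (simp add: A_def B_def flip: sum_divide_distrib)
  qed
  have sum_cA: "(\<Sum>i\<in>UNIV. c i * d i * A i) = 0"
  proof -
    have "(\<Sum>i\<in>UNIV. c i * d i * A i) = (\<Sum>i\<in>UNIV. \<Sum>j\<in>UNIV. qx $ j * (c i * B i j))"
      by (intro sum.cong refl) (simp add: mult.assoc mult.left_commute sum_distrib_left flip: euler)
    also have "\<dots> = (\<Sum>j\<in>UNIV. qx $ j * (\<Sum>i\<in>UNIV. c i * B i j))"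
      by (subst sum.swap) (simp add: sum_distrib_left)
    finally show ?thesis by (simp add: sum_cB)
  qed
  \<comment> \<open>Here \<open>\<mu>\<^sub>i M\<^sub>i\<close> tends to infinity, while \<open>\<mu>\<^sub>i (f\<^sub>i - f)\<close> tends to zero: so \<open>f\<close> and \<open>f\<^sub>i\<close> have the same limit relative to \<open>M\<^sub>i\<close>.\<close>
  have f_lim: "(\<lambda>k. f k / M i k) \<longlonglongrightarrow> A i" if "c i > 0" for i
  proof -
    have "filterlim (\<lambda>k. w i k * N k) at_top sequentially"
      using w that N_top by (rule filterlim_tendsto_pos_mult_at_top)
    then have "(\<lambda>k. inverse (w i k * N k)) \<longlonglongrightarrow> 0"
      by (rule tendsto_inverse_0_at_top)
    then have "(\<lambda>k. poly_eval (F i) (x k) / M i k -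
        \<mu> k $ i * (poly_eval (F i) (x k) - f k) * inverse (w i k * N k)) \<longlonglongrightarrow> A i - 0 * 0"
      by (intro tendsto_diff tendsto_mult A complementary)
    moreover have "poly_eval (F i) (x k) / M i k -
        \<mu> k $ i * (poly_eval (F i) (x k) - f k) * inverse (w i k * N k) = f k / M i k" for k
      using M_pos[of i k] N_pos[of k] \<mu>_pos[of k i] by (simp add: w_def field_simps)
    ultimately show ?thesis by simp
  qed
  have f_sign: "\<forall>\<^sub>F k in sequentially. sgn (f k) = sgn (A i)" if "c i * A i \<noteq> 0" for i
  proof -
    have "c i > 0" using that c_nonneg[of i] by (auto simp: less_le)
    note f_lim[OF this]
    from order_tendstoD[OF this, of 0] that have "\<forall>\<^sub>F k in sequentially. sgn (f k / M i k) = sgn (A i)"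
      by (cases "A i > 0") (auto elim!: eventually_mono simp del: sgn_divide)
    then show ?thesis
      using M_pos by (auto elim!: eventually_mono)
  qed
  \<comment> \<open>All \<open>A i\<close> with \<open>c i > 0\<close> inherit the sign of the one sequence \<open>f\<close>, so the terms of \<open>sum_cA\<close> cannot cancel.\<close>
  have cA: "c i * A i = 0" for i
  proof (rule ccontr)
    assume i: "c i * A i \<noteq> 0"
    have "0 \<le> sgn (A i) * (c i' * d i' * A i')" for i'
    proof (cases "c i' * A i' = 0")
      case False
      from f_sign[OF this] f_sign[OF i] have "\<forall>\<^sub>F k in sequentially. sgn (A i) = sgn (A i')"
        by eventually_elim simp
      then have same: "sgn (A i) = sgn (A i')" by simp
      have "sgn (A i) * (c i' * d i' * A i') = c i' * d i' * (sgn (A i') * A i')"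
        unfolding same by (simp only: mult_ac)
      also have "sgn (A i') * A i' = \<bar>A i'\<bar>" by (simp add: sgn_if abs_if)
      finally have abs: "sgn (A i) * (c i' * d i' * A i') = c i' * d i' * \<bar>A i'\<bar>" .
      show ?thesis unfolding abs using c_nonneg[of i'] d_pos[of i'] by simp
    qed auto
    moreover have "(\<Sum>i'\<in>UNIV. sgn (A i) * (c i' * d i' * A i')) = 0"
      unfolding sum_distrib_left[symmetric] sum_cA by simp
    ultimately have "\<forall>i'. sgn (A i) * (c i' * d i' * A i') = 0"
      using sum_nonneg_eq_0_iff[of UNIV "\<lambda>i'. sgn (A i) * (c i' * d i' * A i')"] by simp
    then have "sgn (A i) * (c i * d i * A i) = 0" by blast
    then show False using i d_pos[of i] by (auto simp: sgn_0_0)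
  qed
  \<comment> \<open>The vector \<open>\<rho>\<close> is a nonzero left kernel vector of the matrix of nondegeneracy at \<open>y\<close>.\<close>
  define \<rho> :: "real ^ 'p" where "\<rho> = (\<chi> i. c i / exp (exponent_point (\<kappa> i) \<bullet> zx))"
  have col: "(\<Sum>i\<in>UNIV. \<rho> $ i * face_matrix F \<Delta> y $ i $ t) = 0" for t
  proof (cases t)
    case (Inl j)
    then show ?thesis
      using sum_cB[of j]
      by (simp add: face_matrix_def partial_deriv_poly_eval \<rho>_def B_def flip: G_def)
  next
    case (Inr i')
    have "\<rho> $ i * face_matrix F \<Delta> y $ i $ t = 0" for i
      using cA[of i] Inr by (auto simp: face_matrix_def \<rho>_def A_def simp flip: G_def)
    then show ?thesis by (intro sum.neutral ballI)
  qed
  have compact: "compact (newton_polyhedron (F i))" and ne: "newton_polyhedron (F i) \<noteq> {}" for i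
    using conv compact_newton_polyhedron convenient_nonempty by (auto simp: convenient_map_def)
  note face_sum = face_at_set_sum[of "\<lambda>i. newton_polyhedron (F i)", OF compact ne, of "- qx"]
  define \<Delta>F where "\<Delta>F = face_at (- qx) (newton_polyhedron_map F)"
  have "face_decomposition F \<Delta>F \<Delta>"
    unfolding face_decomposition_def \<Delta>F_def newton_polyhedron_map_def face_sum(2)
    by (auto simp: \<Delta>_def faces_def)
  moreover have "\<Delta>F \<in> faces_at_infinity F"
  proof -
    have "support_min (- qx) (newton_polyhedron_map F) = - (\<Sum>i\<in>UNIV. d i)"
      unfolding newton_polyhedron_map_def face_sum(1) supp_min by (simp add: sum_negf)
    moreover have "(\<Sum>i\<in>UNIV. d i) > 0" using d_pos by (intro sum_pos) auto
    ultimately have "0 \<notin> \<Delta>F" by (simp add: \<Delta>F_def face_at_def)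
    then show ?thesis by (auto simp: faces_at_infinity_def faces_def \<Delta>F_def)
  qed
  moreover have "y $ j \<noteq> 0" for j
  proof -
    have "(\<lambda>k. \<bar>sign_vector (x k) $ j\<bar>) \<longlonglongrightarrow> \<bar>\<sigma> $ j\<bar>"
      by (intro tendsto_rabs tendsto_vec_nth signs)
    moreover have "\<bar>sign_vector (x k) $ j\<bar> = 1" for k
      using nz by (simp add: sign_vector_def abs_sgn_eq)
    ultimately have "\<bar>\<sigma> $ j\<bar> = 1" by (simp add: LIMSEQ_const_iff)
    then show ?thesis by (auto simp: y_def signed_exp_def)
  qed
  ultimately have "rank (face_matrix F \<Delta> y) = CARD('p)"
    using nondeg unfolding nondegenerate_at_infinity_def by blast
  then obtain v where v: "\<rho> = face_matrix F \<Delta> y *v v"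
    unfolding full_rank_surjective by blast
  have "\<rho> \<bullet> \<rho> = \<rho> \<bullet> (face_matrix F \<Delta> y *v v)" using v by simp
  also have "\<dots> = (\<Sum>i\<in>UNIV. \<Sum>t\<in>UNIV. v $ t * (\<rho> $ i * face_matrix F \<Delta> y $ i $ t))"
    by (simp add: inner_vec_def matrix_vector_mult_def sum_distrib_left mult_ac)
  also have "\<dots> = (\<Sum>t\<in>UNIV. v $ t * (\<Sum>i\<in>UNIV. \<rho> $ i * face_matrix F \<Delta> y $ i $ t))"
    by (subst sum.swap) (simp add: sum_distrib_left)
  also have "\<dots> = 0" by (simp add: col)
  finally have "\<rho> = 0" by simp
  then have "\<rho> $ i0 = 0" by simp
  then show False by (simp add: \<rho>_def c_def)
qed

section \<open>The slope of the maximum at infinity\<close>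

lemma continuous_max_function: "continuous_on UNIV (max_function F)"
  unfolding max_function_def[abs_def]
  by (intro continuous_on_MAX has_derivative_continuous_on[OF has_derivative_at_withinI[OF poly_eval_has_derivative]])

text \<open>Moving along the diagonal \<open>(1, \<dots>, 1)\<close> and raising all multipliers by the same small \<open>t > 0\<close> leaves
all coordinate hyperplanes at once and keeps every strict inequality; complementary slackness
becomes approximate. Vanishing coordinates and
inactive indices then need no separate treatment in the asymptotics.\<close>

lemma approximate_generic_multipliers:
  fixes F :: "'p::finite \<Rightarrow> 'n::finite rpoly" and \<mu> :: "'p \<Rightarrow> real"
  assumes \<mu>: "\<And>i. \<mu> i \<ge> 0" "sum \<mu> UNIV = 1"
    and active: "\<And>i. \<mu> i \<noteq> 0 \<Longrightarrow> poly_eval (F i) x = max_function F x"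
    and small: "norm (\<Sum>i\<in>UNIV. \<mu> i *\<^sub>R poly_gradient (F i) x) < e"
    and far: "norm x > R"
  shows "\<exists>x' (\<mu>' :: real ^ 'p). (\<forall>j. x' $ j \<noteq> 0) \<and> (\<forall>i. \<mu>' $ i > 0) \<and> (\<Sum>i\<in>UNIV. \<mu>' $ i) \<ge> 1 \<and>
    norm x' > R \<and> norm (\<Sum>i\<in>UNIV. \<mu>' $ i *\<^sub>R poly_gradient (F i) x') < e \<and>
    (\<forall>i. \<bar>\<mu>' $ i * (poly_eval (F i) x' - max_function F x')\<bar> < e)"
proof -
  define X where "X t = x + t *\<^sub>R (\<chi> j. 1)" for t
  have X: "(X \<longlongrightarrow> x) (at_right 0)"
    unfolding X_def[abs_def] by (auto intro!: tendsto_eq_intros)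
  have cont: "isCont (poly_eval (F i)) x" for i
    using poly_eval_has_derivative by (rule has_derivative_continuous)
  have poly: "((\<lambda>t. poly_eval (F i) (X t)) \<longlongrightarrow> poly_eval (F i) x) (at_right 0)" for i
    by (rule isCont_tendsto_compose[OF cont X])
  have "isCont (max_function F) x"
    using continuous_max_function[of F] by (simp add: continuous_on_eq_continuous_at)
  then have max: "((\<lambda>t. max_function F (X t)) \<longlongrightarrow> max_function F x) (at_right 0)"
    by (rule isCont_tendsto_compose[OF _ X])
  have e: "e > 0" using small norm_ge_zero le_less_trans by blast
  have "\<forall>\<^sub>F t in at_right 0. X t $ j \<noteq> 0" for j
  proof (cases "x $ j = 0")
    case True
    then show ?thesis
      using eventually_at_right_less[of 0] by (auto simp: X_def elim!: eventually_mono)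
  next
    case False
    then show ?thesis by (rule tendsto_imp_eventually_ne[OF tendsto_vec_nth[OF X]])
  qed
  then have "\<forall>\<^sub>F t in at_right 0. \<forall>j. X t $ j \<noteq> 0" by (simp add: eventually_all_finite)
  moreover have "\<forall>\<^sub>F t in at_right 0. norm (X t) > R"
    using tendsto_norm[OF X] far by (rule order_tendstoD)
  moreover have "((\<lambda>t. norm (\<Sum>i\<in>UNIV. (\<mu> i + t) *\<^sub>R poly_gradient (F i) (X t))) \<longlongrightarrow>
      norm (\<Sum>i\<in>UNIV. (\<mu> i + 0) *\<^sub>R poly_gradient (F i) x)) (at_right 0)"
    by (intro tendsto_norm tendsto_sum tendsto_scaleR tendsto_add tendsto_const
        isCont_tendsto_compose[OF continuous_poly_gradient X] tendsto_ident_at)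
  then have "\<forall>\<^sub>F t in at_right 0. norm (\<Sum>i\<in>UNIV. (\<mu> i + t) *\<^sub>R poly_gradient (F i) (X t)) < e"
    using small by (intro order_tendstoD) auto
  moreover have "\<forall>\<^sub>F t in at_right 0. \<bar>(\<mu> i + t) * (poly_eval (F i) (X t) - max_function F (X t))\<bar> < e" for i
  proof -
    have "((\<lambda>t. \<bar>(\<mu> i + t) * (poly_eval (F i) (X t) - max_function F (X t))\<bar>) \<longlongrightarrow>
        \<bar>(\<mu> i + 0) * (poly_eval (F i) x - max_function F x)\<bar>) (at_right 0)"
      by (intro tendsto_intros poly max)
    moreover have "\<bar>(\<mu> i + 0) * (poly_eval (F i) x - max_function F x)\<bar> = 0"
      using active[of i] by auto
    ultimately show ?thesis using e by (intro order_tendstoD) auto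
  qed
  then have "\<forall>\<^sub>F t in at_right 0. \<forall>i. \<bar>(\<mu> i + t) * (poly_eval (F i) (X t) - max_function F (X t))\<bar> < e"
    by (simp add: eventually_all_finite)
  moreover note eventually_at_right_less[of "0::real"]
  ultimately have "\<forall>\<^sub>F t in at_right (0::real). t > 0 \<and> (\<forall>j. X t $ j \<noteq> 0) \<and> norm (X t) > R \<and>
      norm (\<Sum>i\<in>UNIV. (\<mu> i + t) *\<^sub>R poly_gradient (F i) (X t)) < e \<and>
      (\<forall>i. \<bar>(\<mu> i + t) * (poly_eval (F i) (X t) - max_function F (X t))\<bar> < e)"
    by eventually_elim simp
  then obtain t where t: "t > 0" "\<And>j. X t $ j \<noteq> 0" "norm (X t) > R"
      "norm (\<Sum>i\<in>UNIV. (\<mu> i + t) *\<^sub>R poly_gradient (F i) (X t)) < e"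
      "\<And>i. \<bar>(\<mu> i + t) * (poly_eval (F i) (X t) - max_function F (X t))\<bar> < e"
    using eventually_happens'[OF trivial_limit_at_right_real] by blast
  have "(\<Sum>i\<in>UNIV. \<mu> i + t) \<ge> 1" using \<mu> t(1) by (simp add: sum.distrib)
  moreover have "\<mu> i + t > 0" for i using \<mu>(1)[of i] t(1) by simp
  ultimately show ?thesis
    using t by (intro exI[of _ "X t"] exI[of _ "\<chi> i. \<mu> i + t"]) simp
qed

lemma frechet_subgradients_bounded_below:
  fixes F :: "'p::finite \<Rightarrow> 'n::finite rpoly"
  assumes conv: "convenient_map F" and nondeg: "nondegenerate_at_infinity F"
  shows "\<exists>c>0. \<exists>R>0. \<forall>x. norm x \<ge> R \<longrightarrow>
    (\<forall>v \<in> frechet_subdifferential (max_function F) x. norm v \<ge> c)"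
proof (rule ccontr)
  assume neg: "\<not> ?thesis"
  define P where "P k x \<mu> \<longleftrightarrow> (\<forall>j. x $ j \<noteq> 0) \<and> (\<forall>i. \<mu> $ i > 0) \<and> (\<Sum>i\<in>UNIV. \<mu> $ i) \<ge> 1 \<and>
      norm x > real k \<and> norm (\<Sum>i\<in>UNIV. \<mu> $ i *\<^sub>R poly_gradient (F i) x) < inverse (real (Suc k)) \<and>
      (\<forall>i. \<bar>\<mu> $ i * (poly_eval (F i) x - max_function F x)\<bar> < inverse (real (Suc k)))"
    for k :: nat and x :: "real ^ 'n" and \<mu> :: "real ^ 'p"
  have "\<exists>x \<mu>. P k x \<mu>" for k
  proof -
    have "inverse (real (Suc k)) > 0" "real (Suc k) > 0" by simp_all
    with neg obtain x v where x: "norm x \<ge> real (Suc k)"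
      and v: "v \<in> frechet_subdifferential (max_function F) x" "norm v < inverse (real (Suc k))"
      by (meson not_le)
    obtain \<mu> :: "'p \<Rightarrow> real" where \<mu>: "\<And>i. \<mu> i \<ge> 0" "sum \<mu> UNIV = 1"
      "\<And>i. \<mu> i \<noteq> 0 \<Longrightarrow> poly_eval (F i) x = max_function F x"
      "v = (\<Sum>i\<in>UNIV. \<mu> i *\<^sub>R poly_gradient (F i) x)"
      using frechet_subgradient_max[of "\<lambda>i. poly_eval (F i)" "\<lambda>i. poly_gradient (F i) x" x v,
          OF poly_eval_has_derivative] v(1)
      unfolding max_function_def[abs_def] by blast
    have far: "norm x > real k" using x by simp
    show ?thesis
      unfolding P_def
      using \<mu>(1,2,3) v(2)[unfolded \<mu>(4)] far by (rule approximate_generic_multipliers)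
  qed
  then obtain X \<mu> where P: "\<And>k. P k (X k) (\<mu> k)" by metis
  have "norm (sign_vector (X k)) \<le> real CARD('n)" for k
  proof -
    have "norm (sign_vector (X k)) \<le> (\<Sum>j\<in>UNIV. \<bar>sign_vector (X k) $ j\<bar>)" by (rule norm_le_l1_cart)
    also have "\<dots> \<le> (\<Sum>j\<in>(UNIV::'n set). 1)" by (intro sum_mono) (simp add: sign_vector_def abs_sgn_eq)
    finally show ?thesis by simp
  qed
  then have "bounded (range (\<lambda>k. sign_vector (X k)))" unfolding bounded_iff by blast
  then obtain \<sigma> r1 where r1: "strict_mono (r1 :: nat \<Rightarrow> nat)"
    and \<sigma>: "((\<lambda>k. sign_vector (X k)) \<circ> r1) \<longlonglongrightarrow> \<sigma>"
    using bounded_imp_convergent_subsequence by blast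
  define u where "u k = (log_abs (X k), (\<chi> i. ln (\<mu> k $ i)) :: real ^ 'p)" for k
  define K where "K = (\<Union>i. Poly_Mapping.keys (F i))"
  define S :: "((real ^ 'n) \<times> (real ^ 'p)) set" where
    "S = {0} \<union> range (\<lambda>j. (axis j 1, 0)) \<union> range (\<lambda>i. (0, axis i 1)) \<union>
      (\<lambda>\<kappa>. (exponent_point \<kappa>, 0)) ` K \<union> (\<lambda>(\<kappa>, i). (exponent_point \<kappa>, axis i 1)) ` (K \<times> UNIV)"
  have "finite S" unfolding S_def K_def by simp
  then have "finite ((\<lambda>(s, s'). s - s') ` (S \<times> S))" by simp
  from tropical_limit[OF this, of "\<lambda>k. u (r1 k)"]
  obtain r2 :: "nat \<Rightarrow> nat" and q z where r2: "strict_mono r2"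
    and eq: "\<And>l. l \<in> (\<lambda>(s, s'). s - s') ` (S \<times> S) \<Longrightarrow> l \<bullet> q = 0 \<Longrightarrow>
      (\<lambda>k. l \<bullet> u (r1 (r2 k))) \<longlonglongrightarrow> l \<bullet> z"
    and gt: "\<And>l. l \<in> (\<lambda>(s, s'). s - s') ` (S \<times> S) \<Longrightarrow> l \<bullet> q > 0 \<Longrightarrow>
      filterlim (\<lambda>k. l \<bullet> u (r1 (r2 k))) at_top sequentially"
    and lt: "\<And>l. l \<in> (\<lambda>(s, s'). s - s') ` (S \<times> S) \<Longrightarrow> l \<bullet> q < 0 \<Longrightarrow>
      filterlim (\<lambda>k. l \<bullet> u (r1 (r2 k))) at_bot sequentially" by blast
  define r where "r k = r1 (r2 k)" for k
  have r: "filterlim r sequentially sequentially"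
    using strict_mono_o[OF r1 r2] by (auto simp: r_def[abs_def] o_def intro: filterlim_subseq)
  have u_r: "(log_abs (X (r k)), (\<chi> i. ln (\<mu> (r k) $ i))) = u (r1 (r2 k))" for k
    by (simp add: u_def r_def)
  have inverse_lim: "(\<lambda>k. inverse (real (Suc (r k)))) \<longlonglongrightarrow> 0"
    using filterlim_compose[OF LIMSEQ_inverse_real_of_nat r] .
  have limits: "(\<lambda>k. exp (s \<bullet> u (r1 (r2 k))) / exp (s' \<bullet> u (r1 (r2 k)))) \<longlonglongrightarrow>
      (if s \<bullet> q = s' \<bullet> q then exp ((s - s') \<bullet> z) else 0)"
    if S: "s \<in> S" "s' \<in> S" and le: "s \<bullet> q \<le> s' \<bullet> q" for s s'
  proof -
    have l: "s - s' \<in> (\<lambda>(s, s'). s - s') ` (S \<times> S)" using S by force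
    show ?thesis
    proof (cases "s \<bullet> q = s' \<bullet> q")
      case True
      from tendsto_exp[OF eq[OF l]] True show ?thesis
        by (simp add: inner_diff_left flip: exp_diff)
    next
      case False
      with le have "(s - s') \<bullet> q < 0" by (simp add: inner_diff_left)
      from filterlim_compose[OF exp_at_bot lt[OF l this]] False show ?thesis
        by (simp add: inner_diff_left flip: exp_diff)
    qed
  qed
  have tops: "filterlim (\<lambda>k. exp (s \<bullet> u (r1 (r2 k))) / exp (s' \<bullet> u (r1 (r2 k)))) at_top sequentially"
    if S: "s \<in> S" "s' \<in> S" and less: "s \<bullet> q > s' \<bullet> q" for s s'
  proof -
    have l: "s - s' \<in> (\<lambda>(s, s'). s - s') ` (S \<times> S)" using S by force
    have "(s - s') \<bullet> q > 0" using less by (simp add: inner_diff_left)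
    from filterlim_compose[OF exp_at_top gt[OF l this]] show ?thesis
      by (simp add: inner_diff_left flip: exp_diff)
  qed
  show False
  proof (rule degenerate_limit_contradiction[OF conv nondeg, where x = "\<lambda>k. X (r k)"
        and \<mu> = "\<lambda>k. \<mu> (r k)" and f = "\<lambda>k. max_function F (X (r k))" and \<sigma> = \<sigma> and S = S
        and qx = "fst q" and q\<mu> = "snd q" and zx = "fst z" and z\<mu> = "snd z", unfolded u_r prod.collapse])
    show "X (r k) $ j \<noteq> 0" for k j using P by (simp add: P_def)
    show "\<mu> (r k) $ i > 0" for k i using P by (simp add: P_def)
    show "(\<Sum>i\<in>UNIV. \<mu> (r k) $ i) \<ge> 1" for k using P by (simp add: P_def)
    have "filterlim (\<lambda>k. norm (X k)) at_top sequentially"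
      using P by (intro filterlim_at_top_mono[OF filterlim_real_sequentially] always_eventually)
        (auto simp: P_def less_imp_le)
    from filterlim_compose[OF this r] show "filterlim (\<lambda>k. norm (X (r k))) at_top sequentially" .
    show "(\<lambda>k. \<Sum>i\<in>UNIV. \<mu> (r k) $ i *\<^sub>R poly_gradient (F i) (X (r k))) \<longlonglongrightarrow> 0"
      using P by (intro Lim_null_comparison[OF _ inverse_lim] always_eventually)
        (auto simp: P_def less_imp_le simp del: of_nat_Suc)
    show "(\<lambda>k. \<mu> (r k) $ i * (poly_eval (F i) (X (r k)) - max_function F (X (r k)))) \<longlonglongrightarrow> 0" for i
      using P by (intro Lim_null_comparison[OF _ inverse_lim] always_eventually)
        (auto simp: P_def less_imp_le simp del: of_nat_Suc)
    show "(\<lambda>k. sign_vector (X (r k))) \<longlonglongrightarrow> \<sigma>"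
      using LIMSEQ_subseq_LIMSEQ[OF \<sigma> r2] by (simp add: o_def r_def)
    show "0 \<in> S" "(axis j 1, 0) \<in> S" "(0, axis i 1) \<in> S" for i j by (auto simp: S_def)
    show "(exponent_point \<kappa>, 0) \<in> S" "(exponent_point \<kappa>, axis i' 1) \<in> S"
      if "\<kappa> \<in> Poly_Mapping.keys (F i)" for i i' \<kappa>
    proof -
      have "\<kappa> \<in> K" "(\<kappa>, i') \<in> K \<times> UNIV" using that by (auto simp: K_def)
      then show "(exponent_point \<kappa>, 0) \<in> S" "(exponent_point \<kappa>, axis i' 1) \<in> S"
        unfolding S_def by (auto intro!: image_eqI[of _ "\<lambda>(\<kappa>, i). (exponent_point \<kappa>, axis i 1)"])
    qed
  qed (use limits tops in auto)
qed

text \<open>A limiting subgradient at \<open>x\<close> is a limit of Frechet subgradients at points that converge to \<open>x\<close>.\<close>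

lemma nonsmooth_slope_ge:
  fixes f :: "'a::euclidean_space \<Rightarrow> real"
  assumes "\<forall>\<^sub>F y in nhds x. \<forall>v \<in> frechet_subdifferential f y. norm v \<ge> c"
  shows "nonsmooth_slope f x \<ge> ereal c"
  unfolding nonsmooth_slope_def
proof (rule INF_greatest)
  fix v assume "v \<in> limiting_subdifferential f x"
  then obtain X V r where V: "\<And>k. V k \<in> frechet_subdifferential f (X k)"
    and X: "(\<lambda>k. (X k, f (X k))) \<longlonglongrightarrow> (x, f x)" and r: "strict_mono (r :: nat \<Rightarrow> nat)"
    and v: "(V \<circ> r) \<longlonglongrightarrow> v"
    unfolding limiting_subdifferential_def by blast
  have "(X \<circ> r) \<longlonglongrightarrow> x" using LIMSEQ_subseq_LIMSEQ[OF tendsto_fst[OF X] r] by (simp add: o_def)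
  from eventually_compose_filterlim[OF assms this]
  have "\<forall>\<^sub>F k in sequentially. c \<le> norm ((V \<circ> r) k)"
    by eventually_elim (use V in auto)
  from tendsto_lowerbound[OF tendsto_norm[OF v] this] show "ereal c \<le> ereal (norm v)" by simp
qed

theorem lemma7:
  fixes F :: "'p::finite \<Rightarrow> 'n::finite rpoly"
  assumes "CARD('p) \<le> CARD('n)"
    and "convenient_map F"
    and "nondegenerate_at_infinity F"
    and "{x. max_function F x \<le> 0} \<noteq> {}"
  shows "(\<exists>c>0. \<exists>R>0. \<forall>x. norm x \<ge> R \<longrightarrow> nonsmooth_slope (max_function F) x \<ge> ereal c)
         \<and> good_at_infinity (max_function F)"
proof -
  obtain c R where "c > 0" "R > 0"
    and bound: "\<And>x v. norm x \<ge> R \<Longrightarrow> v \<in> frechet_subdifferential (max_function F) x \<Longrightarrow> norm v \<ge> c"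
    using frechet_subgradients_bounded_below[OF assms(2,3)] by blast
  have slope: "nonsmooth_slope (max_function F) x \<ge> ereal c" if "norm x \<ge> R + 1" for x
  proof (rule nonsmooth_slope_ge)
    have "norm x > R" using that by simp
    with tendsto_norm[OF filterlim_ident] have "\<forall>\<^sub>F y in nhds x. norm y > R" by (rule order_tendstoD)
    then show "\<forall>\<^sub>F y in nhds x. \<forall>v\<in>frechet_subdifferential (max_function F) y. c \<le> norm v"
      by eventually_elim (use bound less_imp_le in blast)
  qed
  have "R + 1 > 0" using \<open>R > 0\<close> by simp
  with slope \<open>c > 0\<close>
  have "\<exists>c>0. \<exists>R>0. \<forall>x. norm x \<ge> R \<longrightarrow> nonsmooth_slope (max_function F) x \<ge> ereal c" by blast
  then show ?thesis
    using continuous_max_function unfolding good_at_infinity_def by blast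
qed

end
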